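(* Let $P$ be a pinwheel tiling, regarded as an infinite planar graph. Then its chromatic number is $\chi(P)=3$.
   Context: Pinwheel substitution. The prototile $K$ is the right triangle with side lengths $1,2,\sqrt5$. The substitution $\omega$ expands a tile by $\sqrt5$ and dissects it into five tiles: the expanded tile, placed as the triangle with vertices $(0,0)$ (right angle), $(2,-1)$, $(2,4)$, is dissected into the triangles with vertices $\{(2,-1),(2,0),(0,0)\}$, $\{(0,0),(1,0),(1,2)\}$, $\{(1,0),(2,0),(1,2)\}$, $\{(2,0),(2,2),(1,2)\}$, $\{(1,2),(2,2),(2,4)\}$. The rule is extended to all congruent copies of $K$ (including reflections) and to collections of tiles covariantly. A pinwheel tiling is a tiling $P$ of $\mathbb{R}^2$ by congruent copies of $K$ such that every finite set of tiles of $P$ is contained in a congruent copy of $\omega^n(K)$ for some $n\ge0$. Graph: the vertices are all points that are a corner of at least one tile; the edges are the segments, contained in tile boundaries, joining consecutive vertices (so a tile side containing vertices in its interior is subdivided by them). *)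

theory Defs
  imports "HOL-Analysis.Analysis" "HOL-Library.Extended_Nat"
begin

section \<open>Chromatic number of a (possibly infinite) graph\<close>

definition colorable :: "'v set \<Rightarrow> 'v set set \<Rightarrow> nat \<Rightarrow> bool" where
  "colorable V E k \<longleftrightarrow>
    (\<exists>c. c ` V \<subseteq> {..<k} \<and> (\<forall>u\<in>V. \<forall>v\<in>V. {u, v} \<in> E \<longrightarrow> c u \<noteq> c v))"

text \<open>The value is \<open>\<infinity>\<close> if no finite number of colours suffices.\<close>

definition chromatic_number :: "'v set \<Rightarrow> 'v set set \<Rightarrow> enat" where
  "chromatic_number V E = (INF k\<in>{k. colorable V E k}. enat k)"

section \<open>Tiles and the pinwheel substitution\<close>

text \<open>The metric on \<^typ>\<open>real \<times> real\<close> is the Euclidean one. Distance-preserving self-maps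
  of the plane are exactly the congruences, reflections included.\<close>

type_synonym plane = "real \<times> real"

definition congruence :: "(plane \<Rightarrow> plane) \<Rightarrow> bool" where
  "congruence g \<longleftrightarrow> (\<forall>x y. dist (g x) (g y) = dist x y)"

definition K :: "plane set" where
  "K = convex hull {(0, 0), (1, 0), (0, 2)}"

definition expanded_K :: "plane set" where
  "expanded_K = convex hull {(0, 0), (2, -1), (2, 4)}"

definition dissection :: "plane set set" where
  "dissection =
    {convex hull {(2, -1), (2, 0), (0, 0)},
     convex hull {(0, 0), (1, 0), (1, 2)},
     convex hull {(1, 0), (2, 0), (1, 2)},
     convex hull {(2, 0), (2, 2), (1, 2)},
     convex hull {(1, 2), (2, 2), (2, 4)}}"

text \<open>For a congruent copy \<open>T\<close> of \<open>K\<close> the congruence \<open>g\<close> below exists, and it is unique because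
  the triangle is scalene; so this is the covariant extension of the dissection rule.\<close>

definition subst_tile :: "plane set \<Rightarrow> plane set set" where
  "subst_tile T =
    {g ` D | g D. congruence g \<and> g ` expanded_K = (\<lambda>x. sqrt 5 *\<^sub>R x) ` T \<and> D \<in> dissection}"

definition subst :: "plane set set \<Rightarrow> plane set set" where
  "subst Q = (\<Union>T\<in>Q. subst_tile T)"

section \<open>Pinwheel tilings\<close>

definition tiling_by_K :: "plane set set \<Rightarrow> bool" where
  "tiling_by_K P \<longleftrightarrow>
    (\<forall>T\<in>P. \<exists>g. congruence g \<and> T = g ` K) \<and>
    \<Union>P = UNIV \<and>
    pairwise (\<lambda>S T. interior S \<inter> interior T = {}) P"

definition pinwheel_tiling :: "plane set set \<Rightarrow> bool" where
  "pinwheel_tiling P \<longleftrightarrow>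
    tiling_by_K P \<and>
    (\<forall>F. finite F \<and> F \<subseteq> P \<longrightarrow>
      (\<exists>n g. congruence g \<and> F \<subseteq> (`) g ` ((subst ^^ n) {K})))"

section \<open>The graph of a tiling\<close>

definition tiling_vertices :: "plane set set \<Rightarrow> plane set" where
  "tiling_vertices P = {v. \<exists>T\<in>P. v extreme_point_of T}"

text \<open>A segment between two consecutive vertices on the boundary of a tile is identified with
  the pair of its endpoints.\<close>

definition tiling_edges :: "plane set set \<Rightarrow> plane set set" where
  "tiling_edges P =
    {{u, v} | u v. u \<in> tiling_vertices P \<and> v \<in> tiling_vertices P \<and> u \<noteq> v \<and>
      open_segment u v \<inter> tiling_vertices P = {} \<and>
      (\<exists>T\<in>P. closed_segment u v \<subseteq> frontier T)}"

end

theory Submission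
  imports Defs
begin

text \<open>Write a tile as \<open>f ` K\<close> with a congruence \<open>f\<close>, and give its right angle \<open>(0,0)\<close>, its other
  corners \<open>(1,0)\<close>, \<open>(0,2)\<close> and the midpoint \<open>(0,1)\<close> of its long leg the coordinates in the tile.
  By induction on the level, tiles of a patch meet only in such a way that these four points
  match: if the hypotenuses of two supertiles overlap in more than an endpoint they coincide, and
  their subdivision is symmetric. So the vertices on a tile are its corners and perhaps the
  midpoint. The coordinates of one tile in terms of another lie in $\mathbb{Z}[1/5]$, hence have a parity,
  and the parity of the coordinate sum changes along every edge, except for a long leg whose midpoint
  is not a vertex. Giving a third colour to the right-angle end of these legs repairs the colouring:
  the supertile structure shows that no two such ends are adjacent and that none is the other end
  of such a leg. A triangle of the graph is the tile in the middle of a supertile, whose long leg is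
  not subdivided.\<close>

section \<open>Congruences and placements of the triangle\<close>

text \<open>The tiles of a pinwheel tiling occur in infinitely many directions, so no lattice
  contains all vertices. What survives is one lattice per supertile: in the frame in which the
  dissection is written down, the corners and the long-leg midpoints of all five parts are integer
  points. Changing the level multiplies by an integer matrix or by such a matrix over 5; since 5 is
  odd, a parity persists although the lattice does not.

  The midpoints have to be carried along because the supertile hypotenuse, from (2,-1) to (2,4), has
  its corners at heights 0 and 2. Reversal sends height s to 3 - s, hence these corners to the
  heights 3 and 1, which are midpoints of long legs. Across a shared hypotenuse the corners alone
  need not match, but corners together with midpoints always do.

  Everything is phrased for congruences instead of point sets: K has no symmetry, so a tile
  determines its placement and coordinates in a tile make sense. Each claim about the infinite
  tiling is read off a single patch that agrees with it on a large enough ball.\<close>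

lemma congruence_dist: "congruence f \<Longrightarrow> dist (f x) (f y) = dist x y"
  unfolding congruence_def by blast

lemma congruence_linear:
  assumes "congruence f"
  obtains l where "orthogonal_transformation l" "\<And>z. f z = f 0 + l z"
proof
  show "orthogonal_transformation (\<lambda>z. f z - f 0)"
    using assms unfolding congruence_def orthogonal_transformation_isometry by (simp add: dist_norm)
qed simp

lemma orthogonal_transformation_plane:
  fixes l :: "plane \<Rightarrow> plane"
  assumes "orthogonal_transformation l"
  obtains a b s where "a\<^sup>2 + b\<^sup>2 = (1::real)" "s = 1 \<or> s = (-1::real)"
    "\<And>x y. l (x, y) = (a * x - s * b * y, b * x + s * a * y)"
proof -
  have lin: "linear l" using assms by (simp add: orthogonal_transformation_def)
  have ip: "l v \<bullet> l w = v \<bullet> w" for v w using assms unfolding orthogonal_transformation_def by blast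
  obtain a b where ab: "l (1,0) = (a,b)" by fastforce
  obtain p q where pq: "l (0,1) = (p,q)" by fastforce
  have 1: "a*a + b*b = 1" using ip[of "(1,0)" "(1,0)"] ab by simp
  have 2: "p*p + q*q = 1" using ip[of "(0,1)" "(0,1)"] pq by simp
  have 3: "a*p + b*q = 0" using ip[of "(1,0)" "(0,1)"] ab pq by simp
  \<comment> \<open>The determinant of the matrix with columns (a,b) and (p,q); the identity for its
    square is Lagrange's.\<close>
  define s where "s = a*q - b*p"
  have "s * s = (a*a+b*b) * (p*p+q*q) - (a*p+b*q) * (a*p+b*q)"
    unfolding s_def by algebra
  then have "s * s = 1" using 1 2 3 by simp
  then have s: "s = 1 \<or> s = -1" by (simp add: square_eq_1_iff)
  \<comment> \<open>The second column is \<open>s\<close> times the first one turned by a right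
    angle; the extra terms are multiples of the relations 1 and 3.\<close>
  have "p = - s * b + (a*p+b*q)*a - (a*a+b*b-1)*p" unfolding s_def by algebra
  then have p: "p = -s * b" using 1 3 by simp
  have "q = s * a + (a*p+b*q)*b - (a*a+b*b-1)*q" unfolding s_def by algebra
  then have q: "q = s * a" using 1 3 by simp
  have "l (x,y) = (a * x - s * b * y, b * x + s * a * y)" for x y
  proof -
    have "l (x,y) = l (x *\<^sub>R (1,0) + y *\<^sub>R (0,1))" by simp
    also have "\<dots> = x *\<^sub>R l (1,0) + y *\<^sub>R l (0,1)"
      using lin by (simp only: linear_add linear_scale)
    finally show ?thesis using ab pq p q by (simp add: algebra_simps)
  qed
  then show ?thesis using that 1 s by (simp add: power2_eq_square)
qed

lemma congruence_coordinates:
  assumes "congruence f"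
  obtains a b s c d where "a\<^sup>2 + b\<^sup>2 = (1::real)" "s = 1 \<or> s = (-1::real)"
    "\<And>x y. f (x, y) = (a * x - s * b * y + c, b * x + s * a * y + d)"
proof -
  obtain l where l: "orthogonal_transformation l" "\<And>z. f z = f 0 + l z"
    using congruence_linear[OF assms] by blast
  obtain a b s where abs: "a\<^sup>2 + b\<^sup>2 = 1" "s = 1 \<or> s = (-1::real)"
    "\<And>x y. l (x, y) = (a * x - s * b * y, b * x + s * a * y)"
    using orthogonal_transformation_plane[OF l(1)] by blast
  obtain c d where "f 0 = (c, d)" by fastforce
  then have "f (x, y) = (a * x - s * b * y + c, b * x + s * a * y + d)" for x y
    unfolding l(2)[of "(x,y)"] abs(3) by simp
  then show ?thesis using that abs by blast
qed

lemma congruence_affine: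
  assumes "congruence f"
  shows "f ((1 - t) *\<^sub>R u + t *\<^sub>R v) = (1 - t) *\<^sub>R f u + t *\<^sub>R f v"
proof -
  obtain l where l: "orthogonal_transformation l" "\<And>z. f z = f 0 + l z"
    using congruence_linear[OF assms] by blast
  have "linear l" using l(1) by (simp add: orthogonal_transformation_def)
  then show ?thesis
    unfolding l(2)[of u] l(2)[of v] l(2)[of "(1 - t) *\<^sub>R u + t *\<^sub>R v"]
    by (simp only: linear_add linear_scale) (simp add: algebra_simps)
qed

lemma congruence_compose: "congruence f \<Longrightarrow> congruence g \<Longrightarrow> congruence (f \<circ> g)"
  unfolding congruence_def o_apply by metis

lemma congruence_id: "congruence id"
  by (simp add: congruence_def)

lemma congruence_bij:
  assumes "congruence f" shows "bij f"
proof -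
  obtain l where l: "orthogonal_transformation l" "\<And>z. f z = f 0 + l z"
    using congruence_linear[OF assms] by blast
  have "bij l" using l(1) by (rule orthogonal_transformation_bij)
  moreover have "f = (+) (f 0) \<circ> l" by (rule ext) (simp only: o_apply l(2)[symmetric])
  moreover have "bij ((+) (f 0))" by (rule bij_plus)
  ultimately show ?thesis by (subst \<open>f = _\<close>) (rule bij_comp)
qed

lemma congruence_inj: "congruence f \<Longrightarrow> f x = f y \<longleftrightarrow> x = y"
  by (metis congruence_bij bij_pointE)

lemma congruence_inv:
  assumes "congruence f" shows "congruence (inv f)"
proof -
  have "dist (inv f x) (inv f y) = dist (f (inv f x)) (f (inv f y))" for x y
    using assms unfolding congruence_def by metis
  then show ?thesis
    using congruence_bij[OF assms] unfolding congruence_def by (simp only: bij_is_surj surj_f_inv_f) simp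
qed

lemma congruence_convex_hull:
  assumes "congruence f" shows "f ` (convex hull S) = convex hull (f ` S)"
proof -
  obtain l where l: "orthogonal_transformation l" "\<And>z. f z = f 0 + l z"
    using congruence_linear[OF assms] by blast
  have "linear l" using l(1) by (simp add: orthogonal_transformation_def)
  moreover have "f ` X = (+) (f 0) ` (l ` X)" for X by (simp only: image_image l(2)[symmetric])
  ultimately show ?thesis by (metis convex_hull_linear_image convex_hull_translation)
qed

section \<open>The triangle as a system of inequalities, and its rigidity\<close>

definition innerK :: "plane set" where
  "innerK = {z. 0 < fst z \<and> 0 < snd z \<and> 2 * fst z + snd z < 2}"

lemma K_eq: "K = {z. 0 \<le> fst z \<and> 0 \<le> snd z \<and> 2 * fst z + snd z \<le> 2}"
proof (intro set_eqI iffI)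
  fix z assume "z \<in> K"
  then show "z \<in> {z. 0 \<le> fst z \<and> 0 \<le> snd z \<and> 2 * fst z + snd z \<le> 2}"
    by (auto simp: K_def convex_hull_3)
next
  fix z :: plane assume z: "z \<in> {z. 0 \<le> fst z \<and> 0 \<le> snd z \<and> 2 * fst z + snd z \<le> 2}"
  have "z = (1 - fst z - snd z / 2) *\<^sub>R (0,0) + fst z *\<^sub>R (1,0) + (snd z / 2) *\<^sub>R (0,2)"
    by (cases z) simp
  moreover have "0 \<le> 1 - fst z - snd z / 2" "0 \<le> fst z" "0 \<le> snd z / 2" using z by auto
  moreover have "(1 - fst z - snd z / 2) + fst z + snd z / 2 = 1" by simp
  ultimately show "z \<in> K" unfolding K_def convex_hull_3 by blast
qed

lemma inner_subset_K: "innerK \<subseteq> K"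
  by (auto simp: innerK_def K_eq)

lemma open_inner: "open innerK"
  unfolding innerK_def by (intro open_Collect_conj open_Collect_less continuous_intros)

lemma K_approx_inner:
  assumes "z \<in> K" "e > 0"
  obtains w where "w \<in> innerK" "dist w z < e"
proof -
  \<comment> \<open>\<open>z\<close> is pulled towards the interior point (1/4, 1/2), which is
    within 2 of every point of K, so the factor e / 3 moves it by less than e.\<close>
  define t where "t = min 1 (e / 3)"
  have t: "0 < t" "t \<le> 1" "t < e / 2" using assms by (auto simp: t_def)
  define w where "w = (1 - t) *\<^sub>R z + t *\<^sub>R (1/4, 1/2)"
  have z: "0 \<le> fst z" "0 \<le> snd z" "2 * fst z + snd z \<le> 2" using assms by (auto simp: K_eq)
  have "w \<in> innerK"
  proof -
    have "(1-t) * (2 * fst z + snd z) \<le> (1-t) * 2" using z t by (intro mult_left_mono) auto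
    moreover have "0 \<le> (1-t) * fst z" "0 \<le> (1-t) * snd z" using z t by auto
    ultimately show ?thesis using t by (simp add: innerK_def w_def algebra_simps)
  qed
  moreover have "dist w z = t * norm ((1/4, 1/2) - z)"
  proof -
    have "w - z = t *\<^sub>R ((1/4, 1/2) - z)" by (simp add: w_def algebra_simps)
    then show ?thesis using t by (simp add: dist_norm)
  qed
  moreover have "norm ((1/4, 1/2) - z) \<le> 2"
  proof -
    have "fst z \<le> 1" "snd z \<le> 2" using z by auto
    then have "\<bar>1/4 - fst z\<bar> \<le> \<bar>1\<bar>" "\<bar>1/2 - snd z\<bar> \<le> \<bar>3/2\<bar>"
      using z by (auto simp: abs_if)
    then have "(1/4 - fst z)\<^sup>2 \<le> 1\<^sup>2" "(1/2 - snd z)\<^sup>2 \<le> (3/2)\<^sup>2" by (simp_all only: abs_le_square_iff)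
    moreover have "(1::real)\<^sup>2 = 1" "(3/2::real)\<^sup>2 = 9/4" "(2::real)\<^sup>2 = 4" by (simp_all add: power2_eq_square)
    ultimately have "(1/4 - fst z)\<^sup>2 + (1/2 - snd z)\<^sup>2 \<le> 2\<^sup>2" by linarith
    then have "norm ((1/4, 1/2) - z) \<le> sqrt (2\<^sup>2)"
      unfolding norm_prod_def by (intro real_sqrt_le_mono) simp
    then show ?thesis by simp
  qed
  ultimately have "dist w z \<le> t * 2" using t by simp
  then show ?thesis using that[OF \<open>w \<in> innerK\<close>] t by simp
qed

lemma dist_plane: "dist (x, y) (u, v) = sqrt ((x - u)\<^sup>2 + (y - v)\<^sup>2)" for x y u v :: real
  by (simp add: dist_prod_def dist_real_def)

lemma dist_plane_sq: "(dist (x, y) (u, v))\<^sup>2 = (x - u)\<^sup>2 + (y - v)\<^sup>2" for x y u v :: real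
  by (simp add: dist_plane)

lemma K_dist:
  assumes "z \<in> K" "w \<in> K" shows "dist z w \<le> sqrt 5"
proof -
  have "\<bar>fst z - fst w\<bar> \<le> \<bar>1\<bar>" "\<bar>snd z - snd w\<bar> \<le> \<bar>2\<bar>"
    using assms by (auto simp: K_eq)
  then have "(fst z - fst w)\<^sup>2 \<le> 1\<^sup>2" "(snd z - snd w)\<^sup>2 \<le> 2\<^sup>2"
    by (simp_all only: abs_le_square_iff)
  then show ?thesis by (cases z; cases w) (simp add: dist_plane)
qed

text \<open>K has width 1 and height 2, so two of its points are sqrt 5 apart only if they are the
  ends of the hypotenuse. Hence \<open>r\<close> keeps or reverses the hypotenuse, and the distances
  to the image of the right angle rule out the reversal.\<close>

lemma congruence_fixes_K:
  assumes r: "congruence r" and K: "r ` K = K"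
  shows "r = id"
proof -
  obtain p q where A: "r (0,0) = (p,q)" by fastforce
  obtain t u where B: "r (1,0) = (t,u)" by fastforce
  obtain v w where C: "r (0,2) = (v,w)" by fastforce
  have "r (0,0) \<in> K" "r (1,0) \<in> K" "r (0,2) \<in> K"
    using K by (auto simp: K_eq)
  then have in_K: "(p,q) \<in> K" "(t,u) \<in> K" "(v,w) \<in> K" by (simp_all add: A B C)
  have ineq: "0 \<le> p" "0 \<le> q" "2*p+q \<le> 2" "0 \<le> t" "0 \<le> u" "2 * t + u \<le> 2" "0 \<le> v" "0 \<le> w" "2 * v + w \<le> 2"
    using in_K by (simp_all add: K_eq)
  have r_dist: "dist (r x) (r y) = dist x y" for x y using r unfolding congruence_def by blast
  have r_dist_sq: "(dist (r x) (r y))\<^sup>2 = (dist x y)\<^sup>2" for x y using r_dist by simp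
  have AB: "(t-p)\<^sup>2 + (u-q)\<^sup>2 = 1" using r_dist_sq[of "(1,0)" "(0,0)"] unfolding A B dist_plane_sq by simp
  have AC: "(v-p)\<^sup>2 + (w-q)\<^sup>2 = 4" using r_dist_sq[of "(0,2)" "(0,0)"] unfolding A C dist_plane_sq by simp
  have BC: "(t-v)\<^sup>2 + (u-w)\<^sup>2 = 5" using r_dist_sq[of "(1,0)" "(0,2)"] unfolding B C dist_plane_sq by simp
  have "\<bar>t - v\<bar> \<le> \<bar>1\<bar>" "\<bar>u - w\<bar> \<le> \<bar>2\<bar>" using ineq by auto
  then have "(t-v)\<^sup>2 \<le> 1\<^sup>2" "(u-w)\<^sup>2 \<le> 2\<^sup>2" by (simp_all only: abs_le_square_iff)
  moreover have "(1::real)\<^sup>2 = 1" "(2::real)\<^sup>2 = 4" by simp_all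
  ultimately have "(t-v)\<^sup>2 = 1\<^sup>2" "(u-w)\<^sup>2 = 2\<^sup>2" using BC by linarith+
  then have tv: "t - v = 1 \<or> t - v = -1" and uw: "u - w = 2 \<or> u - w = -2" unfolding power2_eq_iff .
  consider "t = 1" "u = 0" "v = 0" "w = 2" | "t = 0" "u = 2" "v = 1" "w = 0"
  proof -
    have "t = 1 \<and> u = 0 \<and> v = 0 \<and> w = 2" if "t - v = 1"
    proof -
      have 1: "t = 1" "v = 0" using that ineq by linarith+
      then have "u = 0" using ineq by linarith
      then show ?thesis using 1 uw ineq by linarith
    qed
    moreover have "t = 0 \<and> u = 2 \<and> v = 1 \<and> w = 0" if "t - v = -1"
    proof -
      have 1: "t = 0" "v = 1" using that ineq by linarith+
      then have "w = 0" using ineq by linarith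
      then show ?thesis using 1 uw ineq by linarith
    qed
    ultimately show thesis using tv that by blast
  qed
  then have "p = 0 \<and> q = 0 \<and> t = 1 \<and> u = 0 \<and> v = 0 \<and> w = 2"
  proof cases
    case 1
    have 2: "(1-p)\<^sup>2 + q\<^sup>2 = 1" "p\<^sup>2 + (2-q)\<^sup>2 = 4" using AB AC unfolding 1 by simp_all
    have "((1-p)\<^sup>2 + q\<^sup>2) - (p\<^sup>2 + (2-q)\<^sup>2) = 4 * q - 2 * p - 3" by algebra
    then have p: "p = 2 * q" using 2 by linarith
    \<comment> \<open>The root 4/5 belongs to (8/5, 4/5), the mirror image of the right angle in the
      hypotenuse, which lies outside K.\<close>
    have "q * (5 * q - 4) = (1 - 2 * q)\<^sup>2 + q\<^sup>2 - 1" by algebra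
    then have "q = 0 \<or> 5 * q - 4 = 0" using 2(1) unfolding p by simp
    then show ?thesis using p 1 ineq by auto
  next
    case 2
    have 3: "p\<^sup>2 + (2-q)\<^sup>2 = 1" "(1-p)\<^sup>2 + q\<^sup>2 = 4" using AB AC unfolding 2 by simp_all
    have "(p\<^sup>2 + (2-q)\<^sup>2) - ((1-p)\<^sup>2 + q\<^sup>2) = 3 - 4 * q + 2 * p" by algebra
    then have p: "p = 2 * q - 3" using 3 by linarith
    \<comment> \<open>For the reversed hypotenuse both solutions, (1, 2) and (-3/5, 6/5), lie
      outside K.\<close>
    have "(q - 2) * (5 * q - 6) = (2 * q - 3)\<^sup>2 + (2-q)\<^sup>2 - 1" by algebra
    then have "q - 2 = 0 \<or> 5 * q - 6 = 0" using 3(1) unfolding p by simp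
    then show ?thesis using p 2 ineq by auto
  qed
  then have fixed: "r (0,0) = (0,0)" "r (1,0) = (1,0)" "r (0,2) = (0,2)" using A B C by auto
  obtain a b s c d where abscd: "\<And>x y. r (x, y) = (a * x - s * b * y + c, b * x + s * a * y + d)"
    using congruence_coordinates[OF r] by metis
  have "c = 0" "d = 0" using fixed(1) abscd[of 0 0] by auto
  moreover from this have "a = 1" "b = 0" using fixed(2) abscd[of 1 0] by auto
  moreover from calculation have "s = 1" using fixed(3) abscd[of 0 2] by auto
  ultimately have "r (x, y) = (x, y)" for x y using abscd by simp
  then show ?thesis by (simp add: fun_eq_iff)
qed

text \<open>This makes the coordinates of a point in a tile well defined, so that tiles may be
  replaced by their placements throughout.\<close>

lemma placement_unique:
  assumes "congruence f" "congruence g" "f ` K = g ` K"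
  shows "f = g"
proof -
  have "(inv g \<circ> f) ` K = (inv g \<circ> g) ` K" by (metis assms(3) image_comp)
  also have "\<dots> = K" using congruence_bij[OF assms(2)] by (simp add: bij_is_inj)
  finally have "inv g \<circ> f = id"
    by (rule congruence_fixes_K[OF congruence_compose[OF congruence_inv[OF assms(2)] assms(1)]])
  then have "inv g (f x) = x" for x by (metis comp_apply id_apply)
  then show ?thesis
    using congruence_bij[OF assms(2)] by (metis bij_is_surj ext surj_f_inv_f)
qed


text \<open>A neighbourhood of \<open>f w\<close> lies in the first tile, and every point of the
  second tile, even on its boundary, is a limit of inner points of that tile.\<close>

lemma placement_inner_meet:
  assumes "congruence f" "congruence h" "w \<in> innerK" "f w \<in> h ` K"
  shows "f ` innerK \<inter> h ` innerK \<noteq> {}"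
proof -
  obtain z where z: "z \<in> K" "f w = h z" using assms(4) by blast
  obtain e where e: "e > 0" "ball w e \<subseteq> innerK" using open_inner assms(3) open_contains_ball by blast
  obtain y where y: "y \<in> innerK" "dist y z < e" using K_approx_inner[OF z(1) e(1)] by blast
  have f: "f (inv f x) = x" for x using congruence_bij[OF assms(1)] by (simp add: bij_is_surj surj_f_inv_f)
  have "dist (inv f (h y)) w = dist (h y) (h z)"
    using assms(1) z(2) f unfolding congruence_def by metis
  also have "\<dots> = dist y z" using assms(2) unfolding congruence_def by blast
  finally have "inv f (h y) \<in> innerK" using y e by (auto simp: dist_commute)
  then have "h y \<in> f ` innerK" using f by (metis imageI)
  then show ?thesis using y(1) by blast
qed

section \<open>The substitution acting on placements\<close>

text \<open>\<open>expand\<close> is the similarity with ratio \<open>sqrt 5\<close> that maps \<open>K\<close> onto \<open>expanded_K\<close>, and the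
  \<open>kid\<close> maps below carry \<open>K\<close> onto the triangles of \<open>dissection\<close>, right angle to right angle.
  All of them preserve the integer lattice.\<close>

definition expand :: "plane \<Rightarrow> plane" where
  "expand z = (2 * fst z + snd z, 2 * snd z - fst z)"

definition contract :: "plane \<Rightarrow> plane" where
  "contract z = ((2 * fst z - snd z) / 5, (fst z + 2 * snd z) / 5)"

lemma contract_expand [simp]: "contract (expand z) = z"
  by (cases z) (simp add: expand_def contract_def field_simps)

lemma expand_contract [simp]: "expand (contract z) = z"
  by (cases z) (simp add: expand_def contract_def field_simps)

lemma dist_scaleR_common: "dist (c *\<^sub>R x) (c *\<^sub>R y) = \<bar>c\<bar> * dist x y" for x y :: "'a::real_normed_vector"
  by (simp add: dist_norm flip: scaleR_diff_right)

lemma dist_expand: "dist (expand z) (expand w) = sqrt 5 * dist z w"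
proof -
  have "(dist (expand z) (expand w))\<^sup>2 = 5 * (dist z w)\<^sup>2"
  proof -
    obtain x y u v where "z = (x, y)" "w = (u, v)" by fastforce
    moreover have "((2*x+y) - (2*u+v))\<^sup>2 + ((2*y-x) - (2 * v - u))\<^sup>2 = 5 * ((x - u)\<^sup>2 + (y - v)\<^sup>2)"
      by algebra
    ultimately show ?thesis by (simp only: expand_def dist_plane_sq fst_conv snd_conv)
  qed
  then show ?thesis by (metis real_sqrt_mult real_sqrt_abs abs_of_nonneg zero_le_dist)
qed

lemma dist_contract: "sqrt 5 * dist (contract z) (contract w) = dist z w"
  using dist_expand[of "contract z" "contract w"] by simp

section \<open>The five parts of the expanded triangle\<close>

definition kid_a :: "plane \<Rightarrow> plane" where "kid_a z = (2 - snd z, - fst z)"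
definition kid_b :: "plane \<Rightarrow> plane" where "kid_b z = (1 - fst z, snd z)"
definition kid_c :: "plane \<Rightarrow> plane" where "kid_c z = (1 + fst z, snd z)"
definition kid_d :: "plane \<Rightarrow> plane" where "kid_d z = (2 - fst z, 2 - snd z)"
definition kid_e :: "plane \<Rightarrow> plane" where "kid_e z = (2 - fst z, 2 + snd z)"

definition kids :: "(plane \<Rightarrow> plane) set" where
  "kids = {kid_a, kid_b, kid_c, kid_d, kid_e}"

lemmas kid_defs = kid_a_def kid_b_def kid_c_def kid_d_def kid_e_def

lemma kids_congruence: "k \<in> kids \<Longrightarrow> congruence k"
  unfolding kids_def congruence_def kid_defs
  by (auto simp: dist_prod_def dist_real_def power2_commute add.commute)

lemma kids_dissection: "dissection = (\<lambda>k. k ` K) ` kids"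
proof -
  have "k ` K = convex hull (k ` {(0, 0), (1, 0), (0, 2)})" if "k \<in> kids" for k
    unfolding K_def by (rule congruence_convex_hull[OF kids_congruence[OF that]])
  then have "(\<lambda>k. k ` K) ` kids = (\<lambda>k. convex hull (k ` {(0, 0), (1, 0), (0, 2)})) ` kids"
    by (rule image_cong[OF refl])
  also have "\<dots> = dissection"
    unfolding kids_def dissection_def by (simp add: kid_defs insert_commute)
  finally show ?thesis by simp
qed

lemma expanded_K_eq: "expanded_K = expand ` K"
proof -
  have "linear expand" by (rule linearI) (simp_all add: expand_def algebra_simps)
  then show ?thesis
    unfolding K_def convex_hull_linear_image[OF \<open>linear expand\<close>]
    by (simp add: expanded_K_def) (simp add: expand_def)
qed

lemma expand_K_eq: "expand ` K = {z::plane. fst z \<le> 2 \<and> snd z \<le> 2 * fst z \<and> 0 \<le> fst z + 2 * snd z}"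
proof (intro set_eqI iffI)
  fix z :: plane assume "z \<in> {z::plane. fst z \<le> 2 \<and> snd z \<le> 2 * fst z \<and> 0 \<le> fst z + 2 * snd z}"
  then have "contract z \<in> K" by (auto simp: contract_def K_eq field_simps)
  then show "z \<in> expand ` K" by (metis expand_contract imageI)
qed (auto simp: expand_def K_eq)

lemma expand_inner_eq: "expand ` innerK = {z::plane. fst z < 2 \<and> snd z < 2 * fst z \<and> 0 < fst z + 2 * snd z}"
proof (intro set_eqI iffI)
  fix z :: plane assume "z \<in> {z::plane. fst z < 2 \<and> snd z < 2 * fst z \<and> 0 < fst z + 2 * snd z}"
  then have "contract z \<in> innerK" by (auto simp: contract_def innerK_def field_simps)
  then show "z \<in> expand ` innerK" by (metis expand_contract imageI)
qed (auto simp: expand_def innerK_def)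

lemma kids_K_subset: "k \<in> kids \<Longrightarrow> z \<in> K \<Longrightarrow> k z \<in> expand ` K"
  unfolding expand_K_eq kids_def by (auto simp: kid_defs K_eq)

lemma kids_inner_subset: "k \<in> kids \<Longrightarrow> z \<in> innerK \<Longrightarrow> k z \<in> expand ` innerK"
  unfolding expand_inner_eq kids_def by (auto simp: kid_defs innerK_def)

lemma kids_disjoint:
  assumes "k \<in> kids" "k' \<in> kids" "z \<in> innerK" "w \<in> innerK" "k z = k' w"
  shows "k = k'"
  using assms unfolding kids_def by (auto simp: kid_defs innerK_def)

definition inflate :: "(plane \<Rightarrow> plane) \<Rightarrow> plane \<Rightarrow> plane" where
  "inflate f z = sqrt 5 *\<^sub>R f (contract z)"

lemma inflate_congruence:
  assumes "congruence f" shows "congruence (inflate f)"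
  unfolding congruence_def
proof (intro allI)
  fix x y
  have "dist (inflate f x) (inflate f y) = sqrt 5 * dist (f (contract x)) (f (contract y))"
    by (simp add: inflate_def dist_scaleR_common)
  also have "\<dots> = sqrt 5 * dist (contract x) (contract y)" using assms unfolding congruence_def by metis
  finally show "dist (inflate f x) (inflate f y) = dist x y" by (simp add: dist_contract)
qed

lemma inflate_image: "inflate f ` expand ` X = (\<lambda>x. sqrt 5 *\<^sub>R x) ` f ` X"
  by (simp add: image_image inflate_def)

lemma inflate_mem: "inflate f z \<in> inflate h ` expand ` X \<longleftrightarrow> f (contract z) \<in> h ` X"
  unfolding inflate_image by (auto simp: inflate_def)

lemma inflate_eq_iff: "inflate f z = inflate h w \<longleftrightarrow> f (contract z) = h (contract w)"
  by (simp add: inflate_def)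

text \<open>Scaling \<open>g\<close> back to the size of K reduces this to the uniqueness of
  placements.\<close>

lemma inflate_unique:
  assumes "congruence f" "congruence g" "g ` expanded_K = (\<lambda>x. sqrt 5 *\<^sub>R x) ` f ` K"
  shows "g = inflate f"
proof -
  define g' where "g' = (\<lambda>z. (1 / sqrt 5) *\<^sub>R g (expand z))"
  have "congruence g'"
    unfolding congruence_def
  proof (intro allI)
    fix x y
    have "dist (g' x) (g' y) = (1 / sqrt 5) * dist (g (expand x)) (g (expand y))"
      by (simp add: g'_def dist_scaleR_common)
    also have "dist (g (expand x)) (g (expand y)) = dist (expand x) (expand y)"
      using assms(2) unfolding congruence_def by blast
    finally show "dist (g' x) (g' y) = dist x y" by (simp add: dist_expand)
  qed
  moreover have "g' ` K = (\<lambda>x. (1 / sqrt 5) *\<^sub>R x) ` g ` expand ` K"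
    by (simp add: g'_def image_image)
  then have "g' ` K = (\<lambda>x. (1 / sqrt 5) *\<^sub>R x) ` (\<lambda>x. sqrt 5 *\<^sub>R x) ` f ` K"
    using assms(3) by (simp only: expanded_K_eq)
  then have "g' ` K = f ` K" by (simp add: image_image)
  ultimately have "g' = f" using placement_unique assms(1) by blast
  have "g' (contract z) = (1 / sqrt 5) *\<^sub>R g z" for z by (simp add: g'_def)
  then have "f (contract z) = (1 / sqrt 5) *\<^sub>R g z" for z by (simp only: \<open>g' = f\<close>)
  then show ?thesis by (simp add: inflate_def fun_eq_iff del: split_paired_All)
qed

lemma subst_tile_placement:
  assumes "congruence f"
  shows "subst_tile (f ` K) = (\<lambda>k. (inflate f \<circ> k) ` K) ` kids"
proof -
  have "congruence g \<and> g ` expanded_K = (\<lambda>x. sqrt 5 *\<^sub>R x) ` f ` K \<longleftrightarrow> g = inflate f" for g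
    using inflate_unique[OF assms] inflate_congruence[OF assms] inflate_image[of f K]
    by (metis expanded_K_eq)
  then have "subst_tile (f ` K) = {g ` D | g D. g = inflate f \<and> D \<in> dissection}"
    unfolding subst_tile_def by (intro Collect_cong) metis
  also have "\<dots> = {inflate f ` D | D. D \<in> dissection}" by blast
  also have "\<dots> = (\<lambda>k. (inflate f \<circ> k) ` K) ` kids"
    unfolding kids_dissection by (simp add: setcompr_eq_image image_image image_comp)
  finally show ?thesis .
qed

text \<open>The iterated substitution of a tile with each part recorded by its placement; the
  supertile of \<open>inflate f \<circ> k\<close> and its position \<open>k\<close> there remain
  visible, which the tiles as point sets do not show.\<close>

fun placements :: "(plane \<Rightarrow> plane) \<Rightarrow> nat \<Rightarrow> (plane \<Rightarrow> plane) set" where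
  "placements g 0 = {g}"
| "placements g (Suc n) = {inflate f \<circ> k | f k. f \<in> placements g n \<and> k \<in> kids}"

lemma placements_congruence:
  "congruence g \<Longrightarrow> f \<in> placements g n \<Longrightarrow> congruence f"
  by (induction n arbitrary: f) (auto intro: congruence_compose inflate_congruence kids_congruence simp del: o_apply)

lemma subst_power_placements: "(subst ^^ n) {K} = (\<lambda>f. f ` K) ` placements id n"
proof (induction n)
  case (Suc n)
  have "(subst ^^ Suc n) {K} = (\<Union>f\<in>placements id n. subst_tile (f ` K))"
    by (simp add: Suc.IH subst_def del: id_apply image_id)
  also have "\<dots> = (\<Union>f\<in>placements id n. (\<lambda>k. (inflate f \<circ> k) ` K) ` kids)"
    using subst_tile_placement placements_congruence[OF congruence_id] by (intro SUP_cong) auto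
  also have "\<dots> = (\<lambda>f. f ` K) ` placements id (Suc n)" by fastforce
  finally show ?case .
qed simp

text \<open>A congruence applied after the enlargement by sqrt 5 equals the enlargement of a
  conjugate congruence, which is pushed down level by level to the seed. This absorbs the outer
  congruence in the definition of a pinwheel tiling.\<close>

lemma placements_compose:
  assumes "congruence g" "congruence h"
  shows "\<exists>h'. congruence h' \<and> (\<lambda>f. g \<circ> f) ` placements h n = placements h' n"
  using assms(1)
proof (induction n arbitrary: g)
  case 0
  then show ?case using congruence_compose[OF 0 assms(2)] by (intro exI[of _ "g \<circ> h"]) (simp del: o_apply)
next
  case (Suc n)
  define g' where "g' = (\<lambda>z. (1 / sqrt 5) *\<^sub>R g (sqrt 5 *\<^sub>R z))"
  have "congruence g'"
    unfolding congruence_def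
  proof (intro allI)
    fix x y
    have "dist (g' x) (g' y) = (1 / sqrt 5) * dist (g (sqrt 5 *\<^sub>R x)) (g (sqrt 5 *\<^sub>R y))"
      by (simp add: g'_def dist_scaleR_common)
    also have "dist (g (sqrt 5 *\<^sub>R x)) (g (sqrt 5 *\<^sub>R y)) = dist (sqrt 5 *\<^sub>R x) (sqrt 5 *\<^sub>R y)"
      using Suc.prems unfolding congruence_def by blast
    finally show "dist (g' x) (g' y) = dist x y" by (simp add: dist_scaleR_common)
  qed
  from Suc.IH[OF this] obtain h' where h': "congruence h'"
    "(\<lambda>f. g' \<circ> f) ` placements h n = placements h' n" by blast
  have *: "g \<circ> (inflate f \<circ> k) = inflate (g' \<circ> f) \<circ> k" for f k
    by (simp add: fun_eq_iff inflate_def g'_def)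
  have "x \<in> (\<lambda>f. g \<circ> f) ` placements h (Suc n) \<longleftrightarrow>
      (\<exists>f\<in>placements h n. \<exists>k\<in>kids. x = g \<circ> (inflate f \<circ> k))" for x
    unfolding placements.simps by blast
  moreover have "x \<in> placements h' (Suc n) \<longleftrightarrow>
      (\<exists>f\<in>placements h n. \<exists>k\<in>kids. x = inflate (g' \<circ> f) \<circ> k)" for x
    unfolding placements.simps h'(2)[symmetric] by blast
  ultimately have "(\<lambda>f. g \<circ> f) ` placements h (Suc n) = placements h' (Suc n)"
    by (intro set_eqI) (simp only: *)
  then show ?case using h'(1) by blast
qed

lemma placements_packing:
  assumes "congruence g"
  shows "f \<in> placements g n \<Longrightarrow> h \<in> placements g n \<Longrightarrow> f ` innerK \<inter> h ` innerK \<noteq> {} \<Longrightarrow> f = h"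
proof (induction n arbitrary: f h)
  case (Suc n)
  obtain F k where F: "F \<in> placements g n" "k \<in> kids" "f = inflate F \<circ> k" using Suc.prems by auto
  obtain H l where H: "H \<in> placements g n" "l \<in> kids" "h = inflate H \<circ> l" using Suc.prems by auto
  obtain x where "x \<in> f ` innerK" "x \<in> h ` innerK" using Suc.prems(3) by blast
  then obtain z w where zw: "z \<in> innerK" "w \<in> innerK" "x = f z" "x = h w" by blast
  then have eq: "inflate F (k z) = inflate H (l w)" unfolding F(3) H(3) by simp
  have "contract (k z) \<in> innerK" "contract (l w) \<in> innerK"
    using kids_inner_subset[OF F(2) zw(1)] kids_inner_subset[OF H(2) zw(2)] by auto
  moreover have "F (contract (k z)) = H (contract (l w))" using eq by (simp add: inflate_eq_iff)
  ultimately have FH: "F = H" using Suc.IH[OF F(1) H(1)] by (metis disjoint_iff imageI)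
  then have "k z = l w"
    using eq congruence_inj[OF inflate_congruence[OF placements_congruence[OF assms H(1)]]] by metis
  then have "k = l" by (rule kids_disjoint[OF F(2) H(2) zw(1,2)])
  then show ?case using F(3) H(3) FH by simp
qed simp

lemma placements_eqI:
  assumes "congruence g" "f \<in> placements g n" "h \<in> placements g n" "w \<in> innerK" "f w \<in> h ` K"
  shows "f = h"
  using placements_packing[OF assms(1-3)] placement_inner_meet assms placements_congruence by blast


section \<open>How hypotenuses meet other tiles\<close>

text \<open>Of three affine functions on a segment, one vanishes at an inner point without being
  constantly zero, and the other two are positive there. A small step in the direction in which the
  first one grows makes all three positive: the segment enters the open triangle.\<close>

lemma affine_push_positive:
  fixes a b :: real
  assumes t: "0 < t" "t < 1" and 0: "(1 - t) * a + t * b = 0" "a \<noteq> 0"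
    and pos: "0 < (1 - t) * c + t * d" "0 < (1 - t) * e + t * f"
  shows "\<exists>s. 0 < s \<and> s < 1 \<and> 0 < (1 - s) * a + s * b \<and> 0 < (1 - s) * c + s * d \<and> 0 < (1 - s) * e + s * f"
proof -
  let ?S = "{s. 0 < s \<and> s < 1 \<and> 0 < (1 - s) * c + s * d \<and> 0 < (1 - s) * e + s * f}"
  have "open ?S"
    by (intro open_Collect_conj open_Collect_less continuous_intros)
  moreover have "t \<in> ?S" using t pos by simp
  ultimately obtain \<epsilon> where \<epsilon>: "\<epsilon> > 0" "ball t \<epsilon> \<subseteq> ?S" unfolding open_contains_ball by blast
  have "a \<noteq> b" using 0 by (auto simp: algebra_simps)
  define s where "s = (if a < b then t + \<epsilon> / 2 else t - \<epsilon> / 2)"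
  have "(1 - s) * a + s * b = (s - t) * (b - a) + ((1 - t) * a + t * b)" by (simp add: algebra_simps)
  then have "(1 - s) * a + s * b = (s - t) * (b - a)" using 0 by simp
  moreover have "0 < (s - t) * (b - a)"
  proof (cases "a < b")
    case True then show ?thesis using \<epsilon> by (simp add: s_def)
  next
    case False
    then have "b - a < 0" "s - t < 0" using \<open>a \<noteq> b\<close> \<epsilon> by (auto simp: s_def)
    then show ?thesis by (simp add: mult_neg_neg)
  qed
  moreover have "s \<in> ball t \<epsilon>" using \<epsilon> by (simp add: s_def dist_real_def)
  then have "s \<in> ?S" using \<epsilon>(2) by blast
  ultimately show ?thesis by (intro exI[of _ s]) simp
qed

text \<open>By the intermediate value theorem, a starting value outside the interval would force the
  function to take the value 0 or L before time \<open>t\<close>.\<close>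

lemma segment_avoiding_endpoints_aux:
  fixes a b L t :: real
  assumes t: "0 < t" "t < 1" and p: "0 < (1 - t) * a + t * b" "(1 - t) * a + t * b < L"
    and avoid: "\<And>s. 0 < s \<Longrightarrow> s < 1 \<Longrightarrow> (1 - s) * a + s * b \<noteq> 0 \<and> (1 - s) * a + s * b \<noteq> L"
  shows "0 \<le> a \<and> a \<le> L"
proof (rule ccontr)
  have cont: "continuous_on {0..t} (\<lambda>s. (1 - s) * a + s * b)" by (intro continuous_intros)
  assume "\<not> (0 \<le> a \<and> a \<le> L)"
  then consider "a < 0" | "L < a" by linarith
  then show False
  proof cases
    case 1
    then obtain s where "0 \<le> s" "s \<le> t" "(1 - s) * a + s * b = 0"
      using IVT'[of "\<lambda>s. (1 - s) * a + s * b" 0 0 t] p t cont by auto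
    then show False using avoid[of s] t 1 by (cases "s = 0") auto
  next
    case 2
    then obtain s where "0 \<le> s" "s \<le> t" "(1 - s) * a + s * b = L"
      using IVT2'[of "\<lambda>s. (1 - s) * a + s * b" t L 0] p t cont by auto
    then show False using avoid[of s] t 2 by (cases "s = 0") auto
  qed
qed

lemma segment_avoiding_endpoints:
  fixes a b L t :: real
  assumes t: "0 < t" "t < 1" and p: "0 < (1 - t) * a + t * b" "(1 - t) * a + t * b < L"
    and avoid: "\<And>s. 0 < s \<Longrightarrow> s < 1 \<Longrightarrow> (1 - s) * a + s * b \<noteq> 0 \<and> (1 - s) * a + s * b \<noteq> L"
  shows "0 \<le> a \<and> a \<le> L \<and> 0 \<le> b \<and> b \<le> L"
proof -
  have "(1 - s) * b + s * a \<noteq> 0 \<and> (1 - s) * b + s * a \<noteq> L" if "0 < s" "s < 1" for s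
    using avoid[of "1 - s"] that by (simp add: add.commute)
  then have "0 \<le> b \<and> b \<le> L"
    using segment_avoiding_endpoints_aux[of "1 - t" b a L] t p by (simp add: add.commute)
  then show ?thesis using segment_avoiding_endpoints_aux[OF t p avoid] by blast
qed

text \<open>A segment that touches K but avoids its interior and its corners has to run along one
  side, between the ends of that side. Only the hypotenuse is long enough to hold a segment of
  length sqrt 5, and it is then filled completely.\<close>

lemma hypotenuse_match:
  assumes r: "congruence r" and t: "0 < t" "t < 1" and p: "r (1 - t, 2 * t) \<in> K"
    and avoid_inner: "\<And>z. z \<in> K \<Longrightarrow> r z \<notin> innerK"
    and avoid_corner: "\<And>s. 0 < s \<Longrightarrow> s < 1 \<Longrightarrow> r (1 - s, 2 * s) \<notin> {(0,0), (1,0), (0,2)}"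
  shows "r (1,0) = (1,0) \<and> r (0,2) = (0,2) \<or> r (1,0) = (0,2) \<and> r (0,2) = (1,0)"
proof -
  obtain a c where B: "r (1,0) = (a,c)" by fastforce
  obtain b d where C: "r (0,2) = (b,d)" by fastforce
  have seg: "r (1 - s, 2 * s) = ((1 - s) * a + s * b, (1 - s) * c + s * d)" for s
    using congruence_affine[OF r, of s "(1,0)" "(0,2)"] by (simp add: B C algebra_simps)
  have len: "(a - b)\<^sup>2 + (c - d)\<^sup>2 = 5"
  proof -
    have "dist (r (1,0)) (r (0,2)) = dist (1::real,0::real) (0,2)" using r unfolding congruence_def by blast
    then have "(dist (a,c) (b,d))\<^sup>2 = (dist (1::real,0::real) (0,2))\<^sup>2" by (simp only: B C)
    then show ?thesis unfolding dist_plane_sq by simp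
  qed
  \<comment> \<open>\<open>X\<close>, \<open>Y\<close> and \<open>Z\<close> vanish on the long leg,
    the short leg and the hypotenuse respectively, and are positive inside the triangle.\<close>
  define X where "X s = (1 - s) * a + s * b" for s
  define Y where "Y s = (1 - s) * c + s * d" for s
  define Z where "Z s = (1 - s) * (2 - 2 * a - c) + s * (2 - 2 * b - d)" for s
  have Z: "Z s = 2 - 2 * X s - Y s" for s by (simp add: X_def Y_def Z_def algebra_simps)
  have not_inner: "\<not> (0 < X s \<and> 0 < Y s \<and> 0 < Z s)" if "0 < s" "s < 1" for s
    using avoid_inner[of "(1 - s, 2 * s)"] that seg[of s]
    by (auto simp: K_eq innerK_def X_def[symmetric] Y_def[symmetric] Z)
  have not_corner: "(X s, Y s) \<noteq> (0,0)" "(X s, Y s) \<noteq> (1,0)" "(X s, Y s) \<noteq> (0,2)" if "0 < s" "s < 1" for s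
    using avoid_corner[OF that] seg[of s] by (auto simp: X_def Y_def)
  have in_K: "0 \<le> X t" "0 \<le> Y t" "0 \<le> Z t"
    using p seg[of t] unfolding Z by (auto simp: K_eq X_def Y_def)
  moreover have "X t \<noteq> 0 \<or> Y t \<noteq> 0" "X t \<noteq> 0 \<or> Z t \<noteq> 0" "Y t \<noteq> 0 \<or> Z t \<noteq> 0"
    using not_corner[OF t] Z[of t] by auto
  ultimately consider "X t = 0" "0 < Y t" "0 < Z t" | "Y t = 0" "0 < X t" "0 < Z t" | "Z t = 0" "0 < X t" "0 < Y t"
    using not_inner[OF t] by (metis order_le_less)
  then show ?thesis
  proof cases
    case 1
    have "a = 0"
      using affine_push_positive[of t a b c d "2 - 2 * a - c" "2 - 2 * b - d"] t 1 not_inner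
      unfolding X_def Y_def Z_def by blast
    then have "b = 0" using 1 t by (simp add: X_def)
    have X0: "X s = 0" for s by (simp add: X_def \<open>a = 0\<close> \<open>b = 0\<close>)
    have "0 \<le> c \<and> c \<le> 2 \<and> 0 \<le> d \<and> d \<le> 2"
    proof (rule segment_avoiding_endpoints[OF t])
      show "0 < (1 - t) * c + t * d" "(1 - t) * c + t * d < 2" using 1 Z[of t] by (simp_all add: Y_def)
      show "(1 - s) * c + s * d \<noteq> 0 \<and> (1 - s) * c + s * d \<noteq> 2" if "0 < s" "s < 1" for s
        using not_corner[OF that] X0[of s] by (simp add: Y_def)
    qed
    \<comment> \<open>The moved hypotenuse has length sqrt 5, but the long leg only 2.\<close>
    then have "\<bar>c - d\<bar> \<le> \<bar>2\<bar>" by auto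
    then have "(c - d)\<^sup>2 \<le> 2\<^sup>2" unfolding abs_le_square_iff .
    then show ?thesis using len \<open>a = 0\<close> \<open>b = 0\<close> by simp
  next
    case 2
    have "c = 0"
      using affine_push_positive[of t c d a b "2 - 2 * a - c" "2 - 2 * b - d"] t 2 not_inner
      unfolding X_def Y_def Z_def by blast
    then have "d = 0" using 2 t by (simp add: Y_def)
    have Y0: "Y s = 0" for s by (simp add: Y_def \<open>c = 0\<close> \<open>d = 0\<close>)
    have "0 \<le> a \<and> a \<le> 1 \<and> 0 \<le> b \<and> b \<le> 1"
    proof (rule segment_avoiding_endpoints[OF t])
      show "0 < (1 - t) * a + t * b" "(1 - t) * a + t * b < 1" using 2 Z[of t] by (simp_all add: X_def)
      show "(1 - s) * a + s * b \<noteq> 0 \<and> (1 - s) * a + s * b \<noteq> 1" if "0 < s" "s < 1" for s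
        using not_corner[OF that] Y0[of s] by (simp add: X_def)
    qed
    then have "\<bar>a - b\<bar> \<le> \<bar>1\<bar>" by auto
    then have "(a - b)\<^sup>2 \<le> 1\<^sup>2" unfolding abs_le_square_iff .
    then show ?thesis using len \<open>c = 0\<close> \<open>d = 0\<close> by simp
  next
    case 3
    have "2 - 2 * a - c = 0"
      using affine_push_positive[of t "2 - 2 * a - c" "2 - 2 * b - d" a b c d] t 3 not_inner
      unfolding X_def Y_def Z_def by blast
    then have c: "c = 2 - 2 * a" by simp
    then have "2 - 2 * b - d = 0" using 3 t by (simp add: Z_def)
    then have d: "d = 2 - 2 * b" by simp
    have Y2: "Y s = 2 - 2 * X s" for s by (simp add: X_def Y_def c d algebra_simps)
    have ab: "0 \<le> a \<and> a \<le> 1 \<and> 0 \<le> b \<and> b \<le> 1"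
    proof (rule segment_avoiding_endpoints[OF t])
      show "0 < (1 - t) * a + t * b" "(1 - t) * a + t * b < 1" using 3 Y2[of t] by (simp_all add: X_def)
      show "(1 - s) * a + s * b \<noteq> 0 \<and> (1 - s) * a + s * b \<noteq> 1" if "0 < s" "s < 1" for s
      proof -
        have "X s \<noteq> 0 \<and> X s \<noteq> 1" using not_corner[OF that] Y2[of s] by auto
        then show ?thesis unfolding X_def .
      qed
    qed
    have "(c - d)\<^sup>2 = 4 * (a - b)\<^sup>2" unfolding c d by algebra
    then have "(a - b)\<^sup>2 = 1" using len by simp
    then have "a - b = 1 \<or> a - b = -1" by (simp add: power2_eq_1_iff)
    then have "(a = 1 \<and> b = 0) \<or> (a = 0 \<and> b = 1)" using ab by auto
    then show ?thesis using B C c d by auto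
  qed
qed

section \<open>Lattice points of tiles\<close>

definition int_point :: "plane \<Rightarrow> bool" where
  "int_point z \<longleftrightarrow> fst z \<in> \<int> \<and> snd z \<in> \<int>"

text \<open>These are exactly the lattice points of K, see \<open>int_point_K\<close>; the midpoint
  of the long leg comes in as one of them.\<close>

definition tile_points :: "plane set" where
  "tile_points = {(0,0), (1,0), (0,1), (0,2)}"

lemma tile_points_subset_K: "tile_points \<subseteq> K"
  by (auto simp: tile_points_def K_eq)

lemma tile_points_int: "z \<in> tile_points \<Longrightarrow> int_point z"
  by (auto simp: tile_points_def int_point_def)

lemma int_point_K:
  assumes "int_point z" "z \<in> K" shows "z \<in> tile_points"
proof -
  obtain i j where ij: "z = (of_int i, of_int j)"
    using assms(1) by (cases z) (auto simp: int_point_def elim!: Ints_cases)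
  have "0 \<le> i" "0 \<le> j" "2 * i + j \<le> 2" using assms(2) by (auto simp: ij K_eq)
  then have "i = 0 \<and> (j = 0 \<or> j = 1 \<or> j = 2) \<or> i = 1 \<and> j = 0" by presburger
  then show ?thesis by (auto simp: ij tile_points_def)
qed

lemma kids_int: "k \<in> kids \<Longrightarrow> int_point z \<Longrightarrow> int_point (k z)"
  by (auto simp: kids_def kid_defs int_point_def)

lemma kids_int_D:
  assumes "k \<in> kids" "int_point (k z)" shows "int_point z"
proof -
  have *: "2 - x \<in> \<int> \<longleftrightarrow> x \<in> \<int>" "2 + x \<in> \<int> \<longleftrightarrow> x \<in> \<int>" "1 - x \<in> \<int> \<longleftrightarrow> x \<in> \<int>" "1 + x \<in> \<int> \<longleftrightarrow> x \<in> \<int>" "- x \<in> \<int> \<longleftrightarrow> x \<in> \<int>"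
    for x :: real
    using Ints_diff[of 2 "2 - x"] Ints_diff[of "2 + x" 2] Ints_diff[of 1 "1 - x"] Ints_diff[of "1 + x" 1]
      Ints_minus[of "- x"] by (auto simp del: Ints_minus intro: Ints_diff Ints_add Ints_minus)
  show ?thesis using assms by (auto simp: kids_def kid_defs int_point_def *)
qed

lemma expand_int: "int_point z \<Longrightarrow> int_point (expand z)"
  by (auto simp: expand_def int_point_def)

lemma int_point_expand_K:
  assumes "int_point q" "q \<in> expand ` K"
  shows "q \<in> expand ` tile_points \<or> q \<in> {(1,0), (1,1)} \<or> q \<in> {(2,0), (2,1), (2,2), (2,3)}"
proof -
  obtain i j where ij: "q = (of_int i, of_int j)"
    using assms(1) by (cases q) (auto simp: int_point_def elim!: Ints_cases)
  have "real_of_int i \<le> 2" "real_of_int j \<le> 2 * i" "0 \<le> real_of_int i + 2 * j"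
    using assms(2) unfolding expand_K_eq ij by auto
  then have "i \<le> 2" "j \<le> 2 * i" "0 \<le> i + 2 * j" by linarith+
  then have "i = 0 \<and> j = 0 \<or> i = 1 \<and> (j = 0 \<or> j = 1 \<or> j = 2) \<or>
    i = 2 \<and> (j = -1 \<or> j = 0 \<or> j = 1 \<or> j = 2 \<or> j = 3 \<or> j = 4)" by presburger
  then show ?thesis by (auto simp: ij tile_points_def expand_def)
qed

section \<open>Matching of lattice points between the tiles of a patch\<close>

definition lattice_matching :: "(plane \<Rightarrow> plane) set \<Rightarrow> bool" where
  "lattice_matching G \<longleftrightarrow>
    (\<forall>f\<in>G. \<forall>h\<in>G. \<forall>z\<in>tile_points. f z \<in> h ` K \<longrightarrow> f z \<in> h ` tile_points)"

lemma placements_hypotenuse_match: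
  assumes g: "congruence g" and match: "lattice_matching (placements g n)"
    and F: "F \<in> placements g n" and H: "H \<in> placements g n"
    and t: "0 < t" "t < 1" and p: "F (1 - t, 2 * t) \<in> H ` K"
  shows "F (1,0) = H (1,0) \<and> F (0,2) = H (0,2) \<or> F (1,0) = H (0,2) \<and> F (0,2) = H (1,0)"
proof (cases "F = H")
  case False
  have cF: "congruence F" and cH: "congruence H" using placements_congruence[OF g] F H by auto
  define r where "r = inv H \<circ> F"
  have "congruence r" unfolding r_def by (intro congruence_compose congruence_inv cF cH)
  have Hr: "H (r z) = F z" for z
    unfolding r_def o_apply using congruence_bij[OF cH] by (rule surj_f_inv_f[OF bij_is_surj])
  have mem: "r z \<in> X \<longleftrightarrow> F z \<in> H ` X" for z X
    using congruence_inj[OF cH] Hr[of z] by (metis imageE imageI)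
  have "r (1,0) = (1,0) \<and> r (0,2) = (0,2) \<or> r (1,0) = (0,2) \<and> r (0,2) = (1,0)"
  proof (rule hypotenuse_match[OF \<open>congruence r\<close> t])
    show "r (1 - t, 2 * t) \<in> K" using p mem by blast
    show "r z \<notin> innerK" if "z \<in> K" for z
    proof
      assume "r z \<in> innerK"
      moreover have "H (r z) \<in> F ` K" using Hr that by simp
      ultimately show False using placements_eqI[OF g H F] False by blast
    qed
    show "r (1 - s, 2 * s) \<notin> {(0,0), (1,0), (0,2)}" if s: "0 < s" "s < 1" for s
    proof
      \<comment> \<open>The hypothesis is used with the tiles exchanged: a corner of
        \<open>H\<close> inside the hypotenuse of \<open>F\<close> would be a tile point of
        \<open>F\<close>, but the open hypotenuse contains none.\<close>
      assume "r (1 - s, 2 * s) \<in> {(0,0), (1,0), (0,2)}"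
      then have "r (1 - s, 2 * s) \<in> tile_points" unfolding tile_points_def by blast
      moreover have "H (r (1 - s, 2 * s)) \<in> F ` K"
        using Hr s by (auto intro!: imageI simp: K_eq)
      ultimately have "F (1 - s, 2 * s) \<in> F ` tile_points"
        using match H F Hr unfolding lattice_matching_def by metis
      then have "(1 - s, 2 * s) \<in> tile_points" by (metis congruence_inj[OF cF] imageE)
      then show False using s by (auto simp: tile_points_def)
    qed
  qed
  then show ?thesis using Hr by metis
qed simp

lemma inflate_hypotenuse:
  assumes "congruence F"
  shows "inflate F (2, s) = sqrt 5 *\<^sub>R ((1 - (s + 1) / 5) *\<^sub>R F (1,0) + ((s + 1) / 5) *\<^sub>R F (0,2))"
proof -
  have "contract (2, s) = (1 - (s + 1) / 5) *\<^sub>R (1,0) + ((s + 1) / 5) *\<^sub>R (0,2)"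
    by (simp add: contract_def field_simps)
  then show ?thesis unfolding inflate_def by (simp only: congruence_affine[OF assms])
qed

text \<open>The three cases are the lattice points inherited from the tile before inflation, the interior
  ones, and those on the open hypotenuse, where the hypotenuses of the two inflated tiles coincide
  with equal or opposite directions.\<close>

lemma placements_transfer:
  assumes g: "congruence g" and match: "lattice_matching (placements g n)"
    and F: "F \<in> placements g n" and H: "H \<in> placements g n"
    and q: "int_point q" "q \<in> expand ` K" and p: "inflate F q \<in> inflate H ` expand ` K"
  shows "(\<exists>z\<in>tile_points. \<exists>w\<in>tile_points. q = expand z \<and> inflate F q = inflate H (expand w)) \<or>
    q \<in> {(1,0), (1,1)} \<and> F = H \<or>
    q \<in> {(2,0), (2,1), (2,2), (2,3)} \<and>
      ((\<forall>s. inflate F (2, s) = inflate H (2, s)) \<or> (\<forall>s. inflate F (2, s) = inflate H (2, 3 - s)))"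
proof -
  have cF: "congruence F" and cH: "congruence H" using placements_congruence[OF g] F H by auto
  have Fq: "F (contract q) \<in> H ` K" using p by (simp only: inflate_mem)
  consider "q \<in> expand ` tile_points" | "q \<in> {(1,0), (1,1)}" | "q \<in> {(2,0), (2,1), (2,2), (2,3)}"
    using int_point_expand_K[OF q] by blast
  then show ?thesis
  proof cases
    case 1
    then obtain z where z: "z \<in> tile_points" "q = expand z" by blast
    then have "F z \<in> H ` tile_points" using match F H Fq unfolding lattice_matching_def by auto
    then obtain w where "w \<in> tile_points" "F z = H w" by blast
    then show ?thesis using z by (auto simp: inflate_def)
  next
    case 2
    then have "contract q \<in> innerK" by (auto simp: contract_def innerK_def)
    then have "F = H" using placements_eqI[OF g F H _ Fq] by blast
    then show ?thesis using 2 by blast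
  next
    case 3
    define t where "t = (snd q + 1) / 5"
    have t: "0 < t" "t < 1" using 3 by (auto simp: t_def)
    have "contract q = (1 - t, 2 * t)" using 3 by (auto simp: t_def contract_def)
    then have "F (1 - t, 2 * t) \<in> H ` K" using Fq by simp
    from placements_hypotenuse_match[OF g match F H t this]
    have "(\<forall>s. inflate F (2, s) = inflate H (2, s)) \<or> (\<forall>s. inflate F (2, s) = inflate H (2, 3 - s))"
    proof (elim disjE conjE)
      assume e: "F (1,0) = H (1,0)" "F (0,2) = H (0,2)"
      show ?thesis unfolding inflate_hypotenuse[OF cF] inflate_hypotenuse[OF cH] e by blast
    next
      assume e: "F (1,0) = H (0,2)" "F (0,2) = H (1,0)"
      \<comment> \<open>The heights on the hypotenuse run from -1 to 4, so reversing it replaces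
        \<open>s\<close> by 3 - s.\<close>
      have "1 - (3 - s + 1) / 5 = (s + 1) / 5" "(3 - s + 1) / 5 = 1 - (s + 1) / 5" for s :: real
        by (simp_all add: field_simps)
      then show ?thesis
        unfolding inflate_hypotenuse[OF cF] inflate_hypotenuse[OF cH] e by (metis add.commute)
    qed
    then show ?thesis using 3 by blast
  qed
qed

text \<open>A tile point of one part is a lattice point of its supertile. By
  \<open>placements_transfer\<close> it is also a lattice point of any other supertile containing
  it, hence of each part there that contains it, and the lattice points of a tile are its tile
  points.\<close>

lemma placements_lattice_matching:
  assumes g: "congruence g"
  shows "lattice_matching (placements g n)"
proof (induction n)
  case 0
  show ?case by (simp add: lattice_matching_def)
next
  case (Suc n)
  show ?case
    unfolding lattice_matching_def
  proof (intro ballI impI)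
    fix f h z
    assume f: "f \<in> placements g (Suc n)" and h: "h \<in> placements g (Suc n)"
      and z: "z \<in> tile_points" and p: "f z \<in> h ` K"
    obtain F k where F: "F \<in> placements g n" "k \<in> kids" "f = inflate F \<circ> k" using f by auto
    obtain H l where H: "H \<in> placements g n" "l \<in> kids" "h = inflate H \<circ> l" using h by auto
    obtain w where w: "w \<in> K" "f z = h w" using p by blast
    then have eq: "inflate F (k z) = inflate H (l w)" by (simp add: F H)
    have q: "int_point (k z)" "k z \<in> expand ` K"
      using kids_int[OF F(2) tile_points_int[OF z]] kids_K_subset[OF F(2)] z tile_points_subset_K
      by (simp_all only: subset_iff)
    have mem: "inflate F (k z) \<in> inflate H ` expand ` K"
      unfolding eq using kids_K_subset[OF H(2) w(1)] by blast
    have "\<exists>q'. int_point q' \<and> inflate F (k z) = inflate H q'"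
      using placements_transfer[OF g Suc F(1) H(1) q mem]
    proof (elim disjE bexE conjE)
      fix w' assume "w' \<in> tile_points" "inflate F (k z) = inflate H (expand w')"
      then show ?thesis using expand_int tile_points_int by blast
    next
      assume "F = H" then show ?thesis using q by blast
    next
      assume *: "\<forall>s. inflate F (2, s) = inflate H (2, s)" "k z \<in> {(2,0), (2,1), (2,2), (2,3)}"
      then have "inflate F (k z) = inflate H (k z)" by auto
      then show ?thesis using q(1) by blast
    next
      assume *: "\<forall>s. inflate F (2, s) = inflate H (2, 3 - s)" "k z \<in> {(2,0), (2,1), (2,2), (2,3)}"
      then have "inflate F (k z) = inflate H (2, 3 - snd (k z))" by auto
      moreover have "int_point (2, 3 - snd (k z))" using q by (simp add: int_point_def)
      ultimately show ?thesis by blast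
    qed
    then obtain q' where q': "int_point q'" "inflate F (k z) = inflate H q'" by blast
    have "congruence (inflate H)" using inflate_congruence placements_congruence[OF g H(1)] by blast
    then have "q' = l w" using q' eq congruence_inj by metis
    then have "w \<in> tile_points" using kids_int_D[OF H(2)] q'(1) int_point_K w(1) by blast
    then show "f z \<in> h ` tile_points" using w(2) by simp
  qed
qed


section \<open>Parity of points with coordinates in $\mathbb{Z}[1/5]$\<close>

text \<open>The parity of \<open>5 ^ n * (fst u + snd u)\<close> does not depend on the exponent \<open>n\<close> that makes it
  an integer.\<close>

definition quinary :: "plane \<Rightarrow> bool" where
  "quinary u \<longleftrightarrow> (\<exists>n (i::int) (j::int). 5 ^ n * fst u = of_int i \<and> 5 ^ n * snd u = of_int j)"

definition even_point :: "plane \<Rightarrow> bool" where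
  "even_point u \<longleftrightarrow> (\<exists>n (m::int). 5 ^ n * (fst u + snd u) = of_int (2 * m))"

lemma even_point_iff:
  assumes "5 ^ n * (fst u + snd u) = of_int m"
  shows "even_point u \<longleftrightarrow> even m"
proof
  assume "even_point u"
  then obtain k m' where k: "5 ^ k * (fst u + snd u) = of_int (2 * m')" unfolding even_point_def by blast
  have "5 ^ k * (5 ^ n * (fst u + snd u)) = 5 ^ n * (5 ^ k * (fst u + snd u))" by simp
  then have "real_of_int (5 ^ k * m) = of_int (5 ^ n * (2 * m'))" unfolding assms k by simp
  then have "5 ^ k * m = 5 ^ n * (2 * m')" by (simp only: of_int_eq_iff)
  then have "even (5 ^ k * m)" by simp
  then show "even m" by simp
next
  assume "even m"
  then obtain m' where "m = 2 * m'" by blast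
  then show "even_point u" unfolding even_point_def using assms by blast
qed

text \<open>The flag \<open>e\<close> tells whether parity is kept or flipped. It stays unspecified
  because only comparisons of parities matter, so translations by odd vectors are harmless.\<close>

definition parity_map :: "(plane \<Rightarrow> plane) \<Rightarrow> bool" where
  "parity_map \<gamma> \<longleftrightarrow> (\<forall>u. quinary u \<longrightarrow> quinary (\<gamma> u)) \<and>
    (\<exists>e. \<forall>u. quinary u \<longrightarrow> even_point (\<gamma> u) = (even_point u = e))"

lemma parity_map_id: "parity_map id"
  unfolding parity_map_def by (intro conjI exI[of _ True]) auto

lemma parity_map_compose:
  assumes "parity_map \<gamma>" "parity_map \<delta>" shows "parity_map (\<gamma> \<circ> \<delta>)"
proof -
  obtain e where e: "\<forall>u. quinary u \<longrightarrow> even_point (\<gamma> u) = (even_point u = e)"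
    using assms(1) unfolding parity_map_def by blast
  obtain e' where e': "\<forall>u. quinary u \<longrightarrow> even_point (\<delta> u) = (even_point u = e')"
    using assms(2) unfolding parity_map_def by blast
  have q: "\<forall>u. quinary u \<longrightarrow> quinary (\<gamma> u)" "\<forall>u. quinary u \<longrightarrow> quinary (\<delta> u)"
    using assms unfolding parity_map_def by blast+
  then have "\<forall>u. quinary u \<longrightarrow> even_point ((\<gamma> \<circ> \<delta>) u) = (even_point u = (e' = e))"
    unfolding o_apply using e e' by metis
  then show ?thesis unfolding parity_map_def o_apply using q by blast
qed

text \<open>The coordinate sum of the linear part has the coefficients p + r and q + s. These column
  sums are odd, so modulo 2 it equals the sum of the arguments; the translation adds the constant c
  + d, and powers of 5 are odd.\<close>

lemma parity_map_affine:
  fixes p q r s c d :: int and \<gamma> :: "plane \<Rightarrow> plane"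
  assumes "odd (p + r)" "odd (q + s)"
    and \<gamma>: "\<And>u. 5 ^ j * fst (\<gamma> u) = of_int p * fst u + of_int q * snd u + of_int c"
      "\<And>u. 5 ^ j * snd (\<gamma> u) = of_int r * fst u + of_int s * snd u + of_int d"
  shows "parity_map \<gamma>"
proof -
  have "quinary (\<gamma> u) \<and> even_point (\<gamma> u) = (even_point u = even (c + d))" if "quinary u" for u
  proof -
    obtain n x y where u: "5 ^ n * fst u = of_int x" "5 ^ n * snd u = of_int y"
      using \<open>quinary u\<close> unfolding quinary_def by blast
    have "5 ^ (n + j) * fst (\<gamma> u) = 5 ^ n * (5 ^ j * fst (\<gamma> u))" by (simp add: power_add)
    also have "\<dots> = p * (5 ^ n * fst u) + q * (5 ^ n * snd u) + 5 ^ n * c"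
      unfolding \<gamma> by (simp add: algebra_simps)
    finally have 1: "5 ^ (n + j) * fst (\<gamma> u) = of_int (p * x + q * y + 5 ^ n * c)" unfolding u by simp
    have "5 ^ (n + j) * snd (\<gamma> u) = 5 ^ n * (5 ^ j * snd (\<gamma> u))" by (simp add: power_add)
    also have "\<dots> = r * (5 ^ n * fst u) + s * (5 ^ n * snd u) + 5 ^ n * d"
      unfolding \<gamma> by (simp add: algebra_simps)
    finally have 2: "5 ^ (n + j) * snd (\<gamma> u) = of_int (r * x + s * y + 5 ^ n * d)" unfolding u by simp
    have "quinary (\<gamma> u)" unfolding quinary_def using 1 2 by blast
    moreover have "5 ^ (n + j) * (fst (\<gamma> u) + snd (\<gamma> u)) =
        of_int ((p * x + q * y + 5 ^ n * c) + (r * x + s * y + 5 ^ n * d))"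
      unfolding distrib_left 1 2 by simp
    then have "even_point (\<gamma> u) = even ((p * x + q * y + 5 ^ n * c) + (r * x + s * y + 5 ^ n * d))"
      by (rule even_point_iff)
    moreover have "even ((p * x + q * y + 5 ^ n * c) + (r * x + s * y + 5 ^ n * d)) =
        (even (x + y) = even (c + d))"
      using assms(1,2) by simp blast
    moreover have "5 ^ n * (fst u + snd u) = of_int (x + y)" unfolding distrib_left u by simp
    then have "even_point u = even (x + y)" by (rule even_point_iff)
    ultimately show ?thesis by simp
  qed
  then show ?thesis unfolding parity_map_def by blast
qed

lemma expand_parity: "parity_map expand"
  by (rule parity_map_affine[of 2 "-1" 1 2 0 _ 0 0]) (simp_all add: expand_def)

lemma contract_parity: "parity_map contract"
  by (rule parity_map_affine[of 2 1 "-1" 2 1 _ 0 0]) (simp_all add: contract_def)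

lemma kids_parity: "k \<in> kids \<Longrightarrow> parity_map k"
  unfolding kids_def
proof (elim insertE emptyE; hypsubst)
  show "parity_map kid_a" by (rule parity_map_affine[of 0 "-1" "-1" 0 0 _ 2 0]) (simp_all add: kid_defs)
  show "parity_map kid_b" by (rule parity_map_affine[of "-1" 0 0 1 0 _ 1 0]) (simp_all add: kid_defs)
  show "parity_map kid_c" by (rule parity_map_affine[of 1 0 0 1 0 _ 1 0]) (simp_all add: kid_defs)
  show "parity_map kid_d" by (rule parity_map_affine[of "-1" 0 0 "-1" 0 _ 2 2]) (simp_all add: kid_defs)
  show "parity_map kid_e" by (rule parity_map_affine[of "-1" 0 0 1 0 _ 2 2]) (simp_all add: kid_defs)
qed

lemma kids_inverse_parity:
  assumes "k \<in> kids"
  obtains k' where "parity_map k'" "\<And>z. k (k' z) = z"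
proof -
  let ?a = "\<lambda>z::plane. (- snd z, 2 - fst z)"
  let ?c = "\<lambda>z::plane. (fst z - 1, snd z)"
  let ?e = "\<lambda>z::plane. (2 - fst z, snd z - 2)"
  have "parity_map ?a" by (rule parity_map_affine[of 0 "-1" "-1" 0 0 _ 0 2]) simp_all
  moreover have "parity_map ?c" by (rule parity_map_affine[of 1 0 0 1 0 _ "-1" 0]) simp_all
  moreover have "parity_map ?e" by (rule parity_map_affine[of "-1" 0 0 1 0 _ 2 "-2"]) simp_all
  moreover have "parity_map kid_b" "parity_map kid_d" by (simp_all add: kids_parity kids_def)
  moreover have "kid_a (?a z) = z" "kid_b (kid_b z) = z" "kid_c (?c z) = z" "kid_d (kid_d z) = z" "kid_e (?e z) = z"
    for z by (simp_all add: kid_defs)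
  ultimately show thesis using assms that unfolding kids_def by blast
qed

text \<open>The change of coordinates climbs from \<open>h\<close> to its supertile by
  \<open>l\<close> and \<open>contract\<close>, crosses to the other supertile by induction, and
  descends by \<open>expand\<close> and the inverse of \<open>k\<close>. Only
  \<open>contract\<close> creates denominators, and these are powers of 5.\<close>

lemma placements_parity:
  "f \<in> placements g n \<Longrightarrow> h \<in> placements g n \<Longrightarrow> \<exists>\<gamma>. parity_map \<gamma> \<and> h = f \<circ> \<gamma>"
proof (induction n arbitrary: f h)
  case 0
  then show ?case using parity_map_id by (intro exI[of _ id]) (simp del: id_apply)
next
  case (Suc n)
  obtain F k where F: "F \<in> placements g n" "k \<in> kids" "f = inflate F \<circ> k" using Suc.prems by auto
  obtain H l where H: "H \<in> placements g n" "l \<in> kids" "h = inflate H \<circ> l" using Suc.prems by auto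
  obtain \<gamma> where \<gamma>: "parity_map \<gamma>" "H = F \<circ> \<gamma>" using Suc.IH[OF F(1) H(1)] by blast
  obtain k' where k': "parity_map k'" "\<And>z. k (k' z) = z" using kids_inverse_parity[OF F(2)] by blast
  have "h = f \<circ> (k' \<circ> (expand \<circ> (\<gamma> \<circ> (contract \<circ> l))))"
    unfolding F(3) H(3) \<gamma>(2) by (rule ext) (simp add: k'(2) inflate_def)
  moreover have "parity_map (k' \<circ> (expand \<circ> (\<gamma> \<circ> (contract \<circ> l))))"
    by (intro parity_map_compose k'(1) expand_parity \<gamma>(1) contract_parity kids_parity H(2))
  ultimately show ?case by blast
qed

lemma int_point_quinary: "int_point z \<Longrightarrow> quinary z"
  unfolding int_point_def quinary_def by (intro exI[of _ "0::nat"]) (auto elim!: Ints_cases)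

lemma even_tile_point: "z \<in> tile_points \<Longrightarrow> even_point z \<longleftrightarrow> z \<in> {(0,0), (0,2)}"
  using even_point_iff[of 0 "(0,0)" 0] even_point_iff[of 0 "(1,0)" 1]
    even_point_iff[of 0 "(0,1)" 1] even_point_iff[of 0 "(0,2)" 2]
  by (auto simp: tile_points_def)

section \<open>Patches of pinwheel tilings\<close>

lemma congruence_ball:
  assumes "congruence f" shows "f ` ball w e = ball (f w) e"
proof (intro set_eqI iffI)
  fix x assume "x \<in> f ` ball w e"
  then obtain y where "dist w y < e" "x = f y" by auto
  moreover have "dist (f w) (f y) = dist w y" using assms unfolding congruence_def by blast
  ultimately show "x \<in> ball (f w) e" by simp
next
  fix x assume x: "x \<in> ball (f w) e"
  obtain y where y: "x = f y" using congruence_bij[OF assms] by (metis bij_pointE)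
  have "dist (f w) (f y) = dist w y" using assms unfolding congruence_def by blast
  then show "x \<in> f ` ball w e" using x y by simp
qed

lemma placement_interior:
  assumes f: "congruence f" shows "f ` innerK \<subseteq> interior (f ` K)"
proof
  fix x assume "x \<in> f ` innerK"
  then obtain w where w: "w \<in> innerK" "x = f w" by blast
  obtain e where e: "e > 0" "ball w e \<subseteq> innerK" using open_inner w(1) open_contains_ball by blast
  have "ball (f w) e \<subseteq> f ` K" unfolding congruence_ball[OF f, symmetric] using e(2) inner_subset_K by blast
  then show "x \<in> interior (f ` K)" unfolding w(2) mem_interior using e(1) by blast
qed

section \<open>Local finiteness and agreement with a single patch\<close>

lemma separated_bounded_finite:
  fixes C :: "'a::heine_borel set"
  assumes "bounded C" "r > 0" and sep: "\<And>x y. x \<in> C \<Longrightarrow> y \<in> C \<Longrightarrow> x \<noteq> y \<Longrightarrow> r \<le> dist x y"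
  shows "finite C"
proof (rule ccontr)
  assume "infinite C"
  moreover have "compact (closure C)" using assms(1) by simp
  ultimately obtain x where "x islimpt C"
    using compact_eq_Bolzano_Weierstrass[of "closure C"] closure_subset by blast
  then have approx: "\<exists>y\<in>C. y \<noteq> x \<and> dist y x < e" if "e > 0" for e
    using that unfolding islimpt_approachable by blast
  obtain y where y: "y \<in> C" "y \<noteq> x" "dist y x < r / 2" using approx[of "r / 2"] assms(2) by auto
  obtain y' where y': "y' \<in> C" "y' \<noteq> x" "dist y' x < min (r / 2) (dist y x)"
    using approx[of "min (r / 2) (dist y x)"] assms(2) y(2) by auto
  have "r \<le> dist y y'" using sep[OF y(1) y'(1)] y'(3) by auto
  moreover have "dist y y' \<le> dist y x + dist y' x" by (rule dist_triangle2)
  ultimately show False using y(3) y'(3) by simp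
qed

text \<open>Each tile contains a ball of fixed radius around its copy of one inner point, so these
  points are uniformly separated, and they stay bounded for tiles that meet a ball.\<close>

lemma tiling_locally_finite:
  assumes P: "tiling_by_K P"
  shows "finite {T \<in> P. T \<inter> cball 0 R \<noteq> {}}" (is "finite ?F")
proof -
  obtain f where f: "\<And>T. T \<in> P \<Longrightarrow> congruence (f T) \<and> T = f T ` K"
    using P unfolding tiling_by_K_def by metis
  define w :: plane where "w = (1/4, 1/2)"
  have "w \<in> innerK" by (simp add: w_def innerK_def)
  then obtain e where e: "e > 0" "ball w e \<subseteq> innerK" using open_inner open_contains_ball by blast
  have sep: "S = T" if "S \<in> P" "T \<in> P" "dist (f S w) (f T w) < e" for S T
  proof -
    have "f T w \<in> f S ` innerK"
      using that congruence_ball[of "f S" w e] f e(2) by (metis image_mono mem_ball subsetD)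
    moreover have "f T w \<in> f T ` innerK" using \<open>w \<in> innerK\<close> by blast
    ultimately have "f T w \<in> interior S \<inter> interior T"
      using placement_interior f that by (metis IntI subsetD)
    then show ?thesis using P that unfolding tiling_by_K_def pairwise_def by blast
  qed
  have "finite ((\<lambda>T. f T w) ` ?F)"
  proof (rule separated_bounded_finite[OF _ e(1)])
    show "bounded ((\<lambda>T. f T w) ` ?F)"
      unfolding bounded_def
    proof (intro exI[of _ "0::plane"] exI[of _ "R + sqrt 5"] ballI)
      fix x assume "x \<in> (\<lambda>T. f T w) ` ?F"
      then obtain T p where T: "T \<in> P" "x = f T w" "p \<in> T" "dist 0 p \<le> R"
        unfolding mem_cball[symmetric] by blast
      obtain z where z: "z \<in> K" "p = f T z" using f T by blast
      have "w \<in> K" using \<open>w \<in> innerK\<close> inner_subset_K by blast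
      have "dist p x = dist z w" using f[OF T(1)] z T(2) by (simp only: congruence_dist)
      also have "\<dots> \<le> sqrt 5" using K_dist z \<open>w \<in> K\<close> by blast
      finally show "dist 0 x \<le> R + sqrt 5" using T(4) dist_triangle[of 0 x p] by linarith
    qed
    fix x y assume xy: "x \<in> (\<lambda>T. f T w) ` ?F" "y \<in> (\<lambda>T. f T w) ` ?F" "x \<noteq> y"
    then obtain S T where "S \<in> P" "T \<in> P" "x = f S w" "y = f T w" by blast
    then show "e \<le> dist x y" using sep[of S T] xy(3) by fastforce
  qed
  moreover have "inj_on (\<lambda>T. f T w) ?F"
  proof (rule inj_onI)
    fix S T assume "S \<in> ?F" "T \<in> ?F" "f S w = f T w"
    then show "S = T" using sep[of S T] e(1) by simp
  qed
  ultimately show ?thesis by (rule finite_imageD)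
qed

text \<open>The finitely many tiles near the ball lie in one patch by definition. Conversely, a
  patch tile that meets the ball has an inner point close by; the tile of \<open>P\<close> over this
  point is in the patch too, and overlapping patch tiles are equal. The level is a successor so that
  every such tile has a supertile.\<close>

lemma pinwheel_patch:
  assumes P: "pinwheel_tiling P"
  obtains n g where "congruence g"
    "\<And>f. congruence f \<Longrightarrow> f ` K \<inter> cball 0 R \<noteq> {} \<Longrightarrow> f ` K \<in> P \<longleftrightarrow> f \<in> placements g (Suc n)"
proof -
  have tiling: "tiling_by_K P" using P unfolding pinwheel_tiling_def by blast
  have cover: "\<exists>h. congruence h \<and> h ` K \<in> P \<and> x \<in> h ` K" for x
  proof -
    obtain T where "T \<in> P" "x \<in> T" using tiling unfolding tiling_by_K_def by blast
    moreover from this obtain h where "congruence h" "T = h ` K"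
      using tiling unfolding tiling_by_K_def by blast
    ultimately show ?thesis by blast
  qed
  \<comment> \<open>The 1 leaves room for moving to an inner point of a tile; the 3 makes the ball
    too wide for one tile.\<close>
  define R' where "R' = max R 3 + 1"
  have R': "R + 1 \<le> R'" "3 \<le> R'" by (auto simp: R'_def)
  define F where "F = {T \<in> P. T \<inter> cball 0 R' \<noteq> {}}"
  have "finite F" "F \<subseteq> P" unfolding F_def using tiling_locally_finite[OF tiling] by auto
  then obtain n g where g: "congruence g" "F \<subseteq> (`) g ` ((subst ^^ n) {K})"
    using P unfolding pinwheel_tiling_def by blast
  obtain g' where g': "congruence g'" "(\<lambda>f. g \<circ> f) ` placements id n = placements g' n"
    using placements_compose[OF g(1) congruence_id] by blast
  have in_patch: "f \<in> placements g' n" if f: "congruence f" "f ` K \<in> P" "f ` K \<inter> cball 0 R' \<noteq> {}" for f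
  proof -
    have "f ` K \<in> F" using f unfolding F_def by blast
    then obtain h where h: "h \<in> placements id n" "f ` K = g ` h ` K"
      using g(2) unfolding subst_power_placements by blast
    have "g \<circ> h \<in> placements g' n" using h(1) g'(2) by blast
    moreover have "f = g \<circ> h"
      using placement_unique[OF f(1) placements_congruence[OF g'(1) \<open>g \<circ> h \<in> _\<close>]] h(2) by (metis image_comp)
    ultimately show ?thesis by simp
  qed
  have in_tiling: "f ` K \<in> P" if f: "f \<in> placements g' n" "f ` K \<inter> cball 0 R \<noteq> {}" for f
  proof -
    have cf: "congruence f" using placements_congruence[OF g'(1) f(1)] .
    obtain z where z: "z \<in> K" "dist 0 (f z) \<le> R" using f(2) by auto
    obtain w where w: "w \<in> innerK" "dist w z < 1" using K_approx_inner[OF z(1), of 1] by auto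
    have "dist (f w) (f z) < 1" using w(2) by (simp only: congruence_dist[OF cf])
    then have "dist 0 (f w) \<le> R'"
      using z(2) R'(1) dist_triangle[of 0 "f w" "f z"] by (simp add: dist_commute)
    moreover obtain h where h: "congruence h" "h ` K \<in> P" "f w \<in> h ` K" using cover by blast
    ultimately have "f w \<in> h ` K \<inter> cball 0 R'" by simp
    then have "h \<in> placements g' n" using in_patch[OF h(1,2)] by blast
    then have "f = h" using placements_eqI[OF g'(1) f(1) _ w(1) h(3)] by blast
    then show ?thesis using h(2) by simp
  qed
  have "n \<noteq> 0"
  proof
    \<comment> \<open>A patch of level 0 is a single tile of diameter sqrt 5, which would have to
      contain two points at distance 6.\<close>
    assume "n = 0"
    have "x \<in> g' ` K" if "x \<in> cball 0 R'" for x
    proof -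
      obtain h where h: "congruence h" "h ` K \<in> P" "x \<in> h ` K" using cover by blast
      then have "h \<in> placements g' n" using in_patch[OF h(1,2)] that by blast
      then show ?thesis using h(3) \<open>n = 0\<close> by simp
    qed
    moreover have "(3,0) \<in> cball (0::plane) R'" "(-3,0) \<in> cball (0::plane) R'"
      using R' by (simp_all add: norm_prod_def)
    ultimately obtain z w where zw: "z \<in> K" "w \<in> K" "(3,0) = g' z" "(-3,0) = g' w" by blast
    have "dist (g' z) (g' w) = dist z w" using g'(1) unfolding congruence_def by blast
    then have "dist (3::real,0::real) (-3,0) \<le> sqrt 5"
      using K_dist[OF zw(1,2)] by (simp only: zw(3,4))
    then have "6 \<le> sqrt (5::real)" by (simp add: dist_plane)
    moreover have "sqrt 5 < sqrt (6\<^sup>2)" by (rule real_sqrt_less_mono) simp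
    ultimately show False by simp
  qed
  then obtain m where "n = Suc m" by (cases n) auto
  have "f ` K \<in> P \<longleftrightarrow> f \<in> placements g' (Suc m)" if "congruence f" "f ` K \<inter> cball 0 R \<noteq> {}" for f
  proof -
    have "cball 0 R \<subseteq> cball (0::plane) R'" using R'(1) by auto
    then have "f ` K \<inter> cball 0 R' \<noteq> {}" using that(2) by blast
    then show ?thesis using in_patch[OF that(1)] in_tiling that(2) \<open>n = Suc m\<close> by blast
  qed
  then show thesis using that g'(1) by blast
qed


section \<open>Corners and boundaries of tiles\<close>

abbreviation corners :: "plane set" where
  "corners \<equiv> {(0,0), (1,0), (0,2)}"

lemma corners_subset: "corners \<subseteq> tile_points"
  by (auto simp: tile_points_def)

lemma congruence_open_segment:
  assumes "congruence f"
  shows "f x \<in> open_segment (f a) (f b) \<longleftrightarrow> x \<in> open_segment a b"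
  unfolding in_segment congruence_affine[OF assms, symmetric] congruence_inj[OF assms] by (rule refl)

lemma convex_combination_eq_0:
  fixes p q u :: real
  assumes "0 \<le> p" "0 \<le> q" "0 < u" "u < 1" "(1 - u) * p + u * q = 0"
  shows "p = 0 \<and> q = 0"
proof -
  have "0 \<le> (1 - u) * p" "0 \<le> u * q" using assms by simp_all
  then have "(1 - u) * p = 0" "u * q = 0" using assms(5) by linarith+
  then show ?thesis using assms(3,4) by simp
qed

text \<open>Each side is the zero set in K of an affine function that is nonnegative on K; if it
  vanishes inside a segment in K, it vanishes at both ends. A corner lies on two sides, and these
  determine the point.\<close>

lemma extreme_point_K: "x extreme_point_of K \<longleftrightarrow> x \<in> corners"
proof
  assume "x extreme_point_of K"
  then show "x \<in> corners" unfolding K_def by (rule extreme_point_of_convex_hull)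
next
  assume x: "x \<in> corners"
  have "x \<notin> open_segment a b" if a: "a \<in> K" and b: "b \<in> K" for a b
  proof
    assume "x \<in> open_segment a b"
    then obtain u where u: "a \<noteq> b" "0 < u" "u < 1" "x = (1 - u) *\<^sub>R a + u *\<^sub>R b"
      unfolding in_segment by blast
    have 1: "fst a = 0 \<and> fst b = 0" if "fst x = 0"
      using convex_combination_eq_0[of "fst a" "fst b" u] that a b u by (simp add: K_eq)
    have 2: "snd a = 0 \<and> snd b = 0" if "snd x = 0"
      using convex_combination_eq_0[of "snd a" "snd b" u] that a b u by (simp add: K_eq)
    have 3: "2 - 2 * fst a - snd a = 0 \<and> 2 - 2 * fst b - snd b = 0" if "2 * fst x + snd x = 2"
      using convex_combination_eq_0[of "2 - 2 * fst a - snd a" "2 - 2 * fst b - snd b" u] that a b u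
      by (simp add: K_eq algebra_simps)
    have "fst a = fst b \<and> snd a = snd b" using x 1 2 3 by auto
    then show False using u(1) by (simp add: prod_eq_iff)
  qed
  moreover have "x \<in> K" using x corners_subset tile_points_subset_K by blast
  ultimately show "x extreme_point_of K" unfolding extreme_point_of_def by blast
qed

lemma extreme_point_placement:
  assumes "congruence f"
  shows "x extreme_point_of (f ` K) \<longleftrightarrow> x \<in> f ` corners"
proof -
  have "f z extreme_point_of (f ` K) \<longleftrightarrow> z extreme_point_of K" for z
    unfolding extreme_point_of_def ball_simps congruence_open_segment[OF assms]
    using congruence_inj[OF assms] by (metis imageE imageI)
  then have "x extreme_point_of (f ` K) \<longleftrightarrow> (\<exists>z. x = f z \<and> z \<in> corners)"
    unfolding extreme_point_K[symmetric] extreme_point_of_def by blast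
  then show ?thesis by blast
qed

lemma frontier_placement:
  assumes f: "congruence f" and z: "z \<in> K"
  shows "f z \<in> frontier (f ` K) \<longleftrightarrow> z \<notin> innerK"
proof
  assume "f z \<in> frontier (f ` K)"
  then show "z \<notin> innerK" using placement_interior[OF f] unfolding frontier_def by blast
next
  assume z': "z \<notin> innerK"
  have "f z \<notin> interior (f ` K)"
  proof
    assume "f z \<in> interior (f ` K)"
    then obtain e where e: "e > 0" "ball (f z) e \<subseteq> f ` K" unfolding mem_interior by blast
    then have "f ` ball z e \<subseteq> f ` K" by (simp only: congruence_ball[OF f])
    moreover have "inj f" using congruence_bij[OF f] by (rule bij_is_inj)
    ultimately have ball: "ball z e \<subseteq> K" by (simp only: inj_image_subset_iff)
    obtain x y where xy: "z = (x, y)" by fastforce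
    \<comment> \<open>One shift against each of the three sides makes the corresponding inequality
      strict.\<close>
    have "(x + e / 2, y) \<in> ball z e" "(x - e / 2, y) \<in> ball z e" "(x, y - e / 2) \<in> ball z e"
      using e(1) by (simp_all add: xy dist_plane)
    then have "(x + e / 2, y) \<in> K" "(x - e / 2, y) \<in> K" "(x, y - e / 2) \<in> K" using ball by blast+
    then have "z \<in> innerK" using e(1) by (simp add: xy K_eq innerK_def)
    then show False using z' by simp
  qed
  moreover have "f z \<in> closure (f ` K)" by (rule subsetD[OF closure_subset imageI[OF z]])
  ultimately show "f z \<in> frontier (f ` K)" unfolding frontier_def by blast
qed

lemma frontier_placement_subset:
  assumes "congruence f" shows "frontier (f ` K) \<subseteq> f ` K"
proof -
  have "f ` K = convex hull (f ` corners)" unfolding K_def by (rule congruence_convex_hull[OF assms])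
  then have "compact (f ` K)" by (simp add: finite_imp_compact_convex_hull)
  then show ?thesis by (simp add: compact_imp_closed frontier_subset_closed)
qed

section \<open>Local structure of a pinwheel tiling\<close>

definition tile_of :: "plane set set \<Rightarrow> (plane \<Rightarrow> plane) \<Rightarrow> bool" where
  "tile_of P f \<longleftrightarrow> congruence f \<and> f ` K \<in> P"

lemma tiling_tile_of:
  assumes "pinwheel_tiling P" "T \<in> P"
  obtains f where "tile_of P f" "T = f ` K"
proof -
  obtain f where "congruence f" "T = f ` K"
    using assms unfolding pinwheel_tiling_def tiling_by_K_def by metis
  then show thesis using that assms(2) unfolding tile_of_def by simp
qed

lemma pinwheel_tiling_nonempty:
  assumes "pinwheel_tiling P"
  obtains f where "tile_of P f"
proof -
  have "\<Union>P = UNIV" using assms unfolding pinwheel_tiling_def tiling_by_K_def by simp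
  then obtain T where "T \<in> P" by blast
  then show thesis using that tiling_tile_of[OF assms] by metis
qed

lemma tiling_vertices_iff:
  assumes "pinwheel_tiling P"
  shows "v \<in> tiling_vertices P \<longleftrightarrow> (\<exists>f. tile_of P f \<and> v \<in> f ` corners)"
proof
  assume "v \<in> tiling_vertices P"
  then obtain T where T: "T \<in> P" "v extreme_point_of T" unfolding tiling_vertices_def by blast
  obtain f where f: "tile_of P f" "T = f ` K" using tiling_tile_of[OF assms T(1)] .
  then have "v \<in> f ` corners" using extreme_point_placement T(2) unfolding tile_of_def by simp
  then show "\<exists>f. tile_of P f \<and> v \<in> f ` corners" using f(1) by blast
next
  assume "\<exists>f. tile_of P f \<and> v \<in> f ` corners"
  then obtain f where f: "congruence f" "f ` K \<in> P" "v \<in> f ` corners" unfolding tile_of_def by blast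
  then have "v extreme_point_of (f ` K)" using extreme_point_placement by simp
  then show "v \<in> tiling_vertices P" using f(2) unfolding tiling_vertices_def by blast
qed

lemma pinwheel_patch_points:
  assumes P: "pinwheel_tiling P"
  obtains n g where "congruence g"
    "\<And>f z. congruence f \<Longrightarrow> z \<in> K \<Longrightarrow> norm (f z) \<le> R \<Longrightarrow> tile_of P f \<longleftrightarrow> f \<in> placements g (Suc n)"
proof -
  obtain n g where g: "congruence g"
    "\<And>f. congruence f \<Longrightarrow> f ` K \<inter> cball 0 R \<noteq> {} \<Longrightarrow> f ` K \<in> P \<longleftrightarrow> f \<in> placements g (Suc n)"
    by (rule pinwheel_patch[OF P, where R = R]) (rule that)
  have "tile_of P f \<longleftrightarrow> f \<in> placements g (Suc n)" if "congruence f" "z \<in> K" "norm (f z) \<le> R" for f z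
  proof -
    have "f z \<in> f ` K \<inter> cball 0 R" using that by simp
    then have "f ` K \<inter> cball 0 R \<noteq> {}" by blast
    then show ?thesis using g(2)[OF that(1)] that(1) unfolding tile_of_def by simp
  qed
  then show thesis by (rule that[OF g(1)])
qed

lemma zero_in_K: "(0,0) \<in> K"
  by (simp add: K_eq)

lemma tiling_lattice_matching:
  assumes P: "pinwheel_tiling P" and f: "tile_of P f" and h: "tile_of P h"
    and z: "z \<in> tile_points" "f z \<in> h ` K"
  shows "f z \<in> h ` tile_points"
proof -
  obtain n g where g: "congruence g"
    "\<And>f' z'. congruence f' \<Longrightarrow> z' \<in> K \<Longrightarrow> norm (f' z') \<le> norm (f z) \<Longrightarrow>
      tile_of P f' \<longleftrightarrow> f' \<in> placements g (Suc n)"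
    by (rule pinwheel_patch_points[OF P, where R = "norm (f z)"]) (rule that)
  have cf: "congruence f" and ch: "congruence h" using f h unfolding tile_of_def by blast+
  have "f \<in> placements g (Suc n)" using g(2)[OF cf, of z] f z(1) tile_points_subset_K by blast
  moreover obtain w where "w \<in> K" "f z = h w" using z(2) by blast
  then have "h \<in> placements g (Suc n)" using g(2)[OF ch, of w] h by simp
  ultimately show ?thesis
    using placements_lattice_matching[OF g(1)] z unfolding lattice_matching_def by blast
qed

lemma tiling_parity:
  assumes P: "pinwheel_tiling P" and f: "tile_of P f" and h: "tile_of P h"
  shows "\<exists>\<gamma>. parity_map \<gamma> \<and> h = f \<circ> \<gamma>"
proof -
  obtain n g where g: "congruence g"
    "\<And>f' z'. congruence f' \<Longrightarrow> z' \<in> K \<Longrightarrow> norm (f' z') \<le> max (norm (f (0,0))) (norm (h (0,0))) \<Longrightarrow>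
      tile_of P f' \<longleftrightarrow> f' \<in> placements g (Suc n)"
    by (rule pinwheel_patch_points[OF P, where R = "max (norm (f (0,0))) (norm (h (0,0)))"]) (rule that)
  have "congruence f" "congruence h" using f h unfolding tile_of_def by blast+
  then have "f \<in> placements g (Suc n)" "h \<in> placements g (Suc n)"
    using g(2)[of f "(0,0)"] g(2)[of h "(0,0)"] f h zero_in_K by simp_all
  then show ?thesis by (rule placements_parity)
qed

lemma expand_K_dist:
  assumes "p \<in> expand ` K" "q \<in> expand ` K" shows "dist p q \<le> 5"
proof -
  obtain z w where zw: "z \<in> K" "w \<in> K" "p = expand z" "q = expand w" using assms by blast
  have "dist p q = sqrt 5 * dist z w" unfolding zw by (rule dist_expand)
  also have "\<dots> \<le> sqrt 5 * sqrt 5" using K_dist[OF zw(1,2)] by (intro mult_left_mono) simp_all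
  finally show ?thesis by simp
qed

text \<open>A supertile has diameter 5. If it reaches into the ball of radius \<open>R\<close>, all
  its parts meet the ball of radius R + 5, on which the patch agrees with the tiling; so all five
  parts are tiles of \<open>P\<close>.\<close>

lemma pinwheel_supertiles:
  assumes P: "pinwheel_tiling P"
  obtains n g where "congruence g"
    "\<And>f z. tile_of P f \<Longrightarrow> z \<in> K \<Longrightarrow> norm (f z) \<le> R \<Longrightarrow>
      \<exists>F\<in>placements g n. \<exists>k\<in>kids. f = inflate F \<circ> k"
    "\<And>G q k. G \<in> placements g n \<Longrightarrow> q \<in> expand ` K \<Longrightarrow> norm (inflate G q) \<le> R \<Longrightarrow> k \<in> kids \<Longrightarrow>
      tile_of P (inflate G \<circ> k)"
proof -
  obtain n g where g: "congruence g"
    "\<And>f z. congruence f \<Longrightarrow> z \<in> K \<Longrightarrow> norm (f z) \<le> R + 5 \<Longrightarrow> tile_of P f \<longleftrightarrow> f \<in> placements g (Suc n)"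
    by (rule pinwheel_patch_points[OF P, where R = "R + 5"]) (rule that)
  show thesis
  proof (rule that[of g n])
    show "congruence g" by (rule g(1))
  next
    fix f z assume f: "tile_of P f" "z \<in> K" "norm (f z) \<le> R"
    have "congruence f" using f(1) unfolding tile_of_def by blast
    then have "f \<in> placements g (Suc n)" using g(2)[of f z] f by simp
    then show "\<exists>F\<in>placements g n. \<exists>k\<in>kids. f = inflate F \<circ> k" unfolding placements.simps by blast
  next
    fix G q k assume G: "G \<in> placements g n" "q \<in> expand ` K" "norm (inflate G q) \<le> R" "k \<in> kids"
    have in_G: "inflate G \<circ> k \<in> placements g (Suc n)" unfolding placements.simps using G(1,4) by blast
    have cG: "congruence (inflate G)" using inflate_congruence placements_congruence[OF g(1) G(1)] by blast
    have "dist (inflate G (k (0,0))) (inflate G q) = dist (k (0,0)) q"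
      by (rule congruence_dist[OF cG])
    also have "\<dots> \<le> 5" by (rule expand_K_dist[OF kids_K_subset[OF G(4) zero_in_K] G(2)])
    finally have "dist (inflate G (k (0,0))) (inflate G q) \<le> 5" .
    moreover have "norm (inflate G (k (0,0))) \<le> norm (inflate G q) + dist (inflate G (k (0,0))) (inflate G q)"
      unfolding dist_norm by (rule norm_triangle_sub)
    ultimately have "norm ((inflate G \<circ> k) (0,0)) \<le> R + 5" using G(3) by simp
    then show "tile_of P (inflate G \<circ> k)"
      using g(2)[OF placements_congruence[OF g(1) in_G] zero_in_K] in_G by blast
  qed
qed

text \<open>An undivided long leg belongs to part \<open>b\<close> or \<open>c\<close> of its supertile, or to part \<open>d\<close> or \<open>e\<close> when
  the supertile shares its hypotenuse with one that points in the same direction: for opposite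
  directions the midpoint of the leg is a corner on the other side.\<close>

lemma apex_neighbours:
  assumes P: "pinwheel_tiling P" and f: "tile_of P f" and M: "f (0,1) \<notin> tiling_vertices P"
    and h: "tile_of P h" and z: "z \<in> tile_points" "h z = f (0,0)"
  shows "z = (0,0) \<or> z = (0,1) \<and> (\<exists>h'. tile_of P h' \<and> h' (1,0) = h (0,0))"
proof -
  obtain n g where g: "congruence g"
    and super: "\<And>f' z'. tile_of P f' \<Longrightarrow> z' \<in> K \<Longrightarrow> norm (f' z') \<le> norm (f (0,0)) \<Longrightarrow>
      \<exists>F\<in>placements g n. \<exists>k\<in>kids. f' = inflate F \<circ> k"
    and sibling: "\<And>G q k. G \<in> placements g n \<Longrightarrow> q \<in> expand ` K \<Longrightarrow> norm (inflate G q) \<le> norm (f (0,0)) \<Longrightarrow>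
      k \<in> kids \<Longrightarrow> tile_of P (inflate G \<circ> k)"
    by (rule pinwheel_supertiles[OF P, where R = "norm (f (0,0))"]) (rule that)
  have zK: "z \<in> K" using z(1) tile_points_subset_K by blast
  obtain F k where F: "F \<in> placements g n" "k \<in> kids" "f = inflate F \<circ> k"
    using super[OF f zero_in_K] by auto
  obtain H l where H: "H \<in> placements g n" "l \<in> kids" "h = inflate H \<circ> l"
    using super[OF h zK] z(2) by auto
  have kA: "k (0,0) \<in> expand ` K" and lz: "l z \<in> expand ` K"
    using kids_K_subset F(2) H(2) zero_in_K zK by blast+
  have sF: "tile_of P (inflate F \<circ> k')" if "k' \<in> kids" for k'
    using sibling[OF F(1) kA _ that] F(3) by simp
  have sH: "tile_of P (inflate H \<circ> k')" if "k' \<in> kids" for k'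
    using sibling[OF H(1) lz _ that] H(3) z(2) by simp
  have vertex: "inflate G (k' (0,0)) \<in> tiling_vertices P" if "tile_of P (inflate G \<circ> k')" for G k'
  proof -
    have "inflate G (k' (0,0)) \<in> (inflate G \<circ> k') ` corners" by simp
    then show ?thesis unfolding tiling_vertices_iff[OF P] using that by blast
  qed
  have cF: "congruence (inflate F)" and cH: "congruence (inflate H)"
    using inflate_congruence placements_congruence[OF g] F(1) H(1) by blast+
  have eq: "inflate F (k (0,0)) = inflate H (l z)" using z(2) F(3) H(3) by simp
  then have mem: "inflate F (k (0,0)) \<in> inflate H ` expand ` K" using lz by blast
  have int: "int_point (k (0,0))" by (rule kids_int[OF F(2)]) (simp add: int_point_def)
  have M': "inflate F (k (0,1)) \<notin> tiling_vertices P" using M F(3) by simp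
  note transfer = placements_transfer[OF g placements_lattice_matching[OF g] F(1) H(1) int kA mem]
  consider "k = kid_a" | "k = kid_b \<or> k = kid_c" | "k = kid_d \<or> k = kid_e"
    using F(2) unfolding kids_def by blast
  then show ?thesis
  proof cases
    case 1
    \<comment> \<open>The long leg of part a is always divided, by the right angle of part
      b.\<close>
    have "k (0,1) = kid_b (0,0)" unfolding 1 by (simp add: kid_defs)
    then show ?thesis using M' vertex[OF sF, of kid_b] by (simp add: kids_def)
  next
    case 2
    then have q: "k (0,0) = (1,0)" by (auto simp: kid_defs)
    \<comment> \<open>(1,0) is interior to the supertile. Besides the right angles of b and c it is
      only the midpoint of the long leg of a, whose right angle (2,0) is the short-leg end of
      c.\<close>
    have "F = H" using transfer unfolding q by (auto simp: tile_points_def expand_def)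
    then have lz: "l z = (1,0)" using eq congruence_inj[OF cH] q by simp
    have "z = (0,0) \<or> z = (0,1) \<and> l = kid_a"
      using lz z(1) H(2) unfolding kids_def tile_points_def by (auto simp: kid_defs)
    moreover have "(inflate F \<circ> kid_c) (1,0) = h (0,0)" if "l = kid_a"
      using that \<open>F = H\<close> by (simp add: H(3) kid_defs)
    moreover have "tile_of P (inflate F \<circ> kid_c)" by (rule sF) (simp add: kids_def)
    ultimately show ?thesis by blast
  next
    case 3
    then have q: "k (0,0) = (2,2)" by (auto simp: kid_defs)
    have "(\<forall>s. inflate F (2, s) = inflate H (2, s)) \<or> (\<forall>s. inflate F (2, s) = inflate H (2, 3 - s)) \<or> F = H"
      using transfer unfolding q by (auto simp: tile_points_def expand_def)
    moreover have "\<not> (\<forall>s. inflate F (2, s) = inflate H (2, 3 - s))"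
    proof
      assume *: "\<forall>s. inflate F (2, s) = inflate H (2, 3 - s)"
      from 3 show False
      proof
        assume "k = kid_d"
        \<comment> \<open>Height 1 is reversed to height 2, the right angle of part d; for part e,
          height 3 becomes height 0, the right angle of part a.\<close>
        then have "inflate F (k (0,1)) = inflate H (kid_d (0,0))" using *[rule_format, of 1] by (simp add: kid_defs)
        then show False using M' vertex[OF sH, of kid_d] by (simp add: kids_def)
      next
        assume "k = kid_e"
        then have "inflate F (k (0,1)) = inflate H (kid_a (0,0))" using *[rule_format, of 3] by (simp add: kid_defs)
        then show False using M' vertex[OF sH, of kid_a] by (simp add: kids_def)
      qed
    qed
    ultimately have "inflate F (2,2) = inflate H (2,2)" by auto
    then have lz: "l z = (2,2)" using eq congruence_inj[OF cH] q by metis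
    have "z = (0,0)"
      using lz z(1) H(2) unfolding kids_def tile_points_def by (auto simp: kid_defs)
    then show ?thesis by simp
  qed
qed

section \<open>Colouring\<close>

text \<open>Vertices on the boundary of a tile are tile points by lattice matching. The midpoint of
  the edge yields the rest: between (1,0) and (0,1) it would be inside the tile, and on a full long
  leg it is (0,1), which cannot be a vertex.\<close>

lemma tiling_edge_cases:
  assumes P: "pinwheel_tiling P" and edge: "{u, v} \<in> tiling_edges P"
  obtains f z w where "tile_of P f" "u = f z" "v = f w" "z \<in> tile_points" "w \<in> tile_points" "z \<noteq> w"
    "{z, w} \<noteq> {(1,0), (0,1)}" "{z, w} = {(0,0), (0,2)} \<Longrightarrow> f (0,1) \<notin> tiling_vertices P"
proof -
  let ?V = "tiling_vertices P"
  obtain u' v' where uv': "{u, v} = {u', v'}" "u' \<in> ?V" "v' \<in> ?V" "u' \<noteq> v'"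
    "open_segment u' v' \<inter> ?V = {}" "\<exists>T\<in>P. closed_segment u' v' \<subseteq> frontier T"
    using edge unfolding tiling_edges_def by blast
  have "open_segment u v = open_segment u' v'" "closed_segment u v = closed_segment u' v'"
    using uv'(1) unfolding doubleton_eq_iff by (metis open_segment_commute, metis closed_segment_commute)
  then obtain T where uv: "u \<in> ?V" "v \<in> ?V" "u \<noteq> v" "open_segment u v \<inter> ?V = {}"
    and T: "T \<in> P" "closed_segment u v \<subseteq> frontier T"
    using uv' unfolding doubleton_eq_iff by metis
  obtain f where f: "tile_of P f" "T = f ` K" using tiling_tile_of[OF P T(1)] .
  have cf: "congruence f" using f(1) unfolding tile_of_def by blast
  have tile_point: "x \<in> f ` tile_points" if x: "x \<in> ?V" "x \<in> closed_segment u v" for x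
  proof -
    have "x \<in> f ` K" using x(2) T(2) frontier_placement_subset[OF cf] unfolding f(2) by blast
    moreover obtain h y where h: "tile_of P h" "y \<in> tile_points" "x = h y"
      using x(1) corners_subset unfolding tiling_vertices_iff[OF P] by blast
    ultimately show ?thesis using tiling_lattice_matching[OF P h(1) f(1) h(2)] by simp
  qed
  obtain z where z: "z \<in> tile_points" "u = f z" using tile_point[OF uv(1)] by auto
  obtain w where w: "w \<in> tile_points" "v = f w" using tile_point[OF uv(2)] by auto
  have mid: "f ((1/2) *\<^sub>R z + (1/2) *\<^sub>R w) \<in> open_segment u v" if "z \<noteq> w"
  proof -
    have "(1/2) *\<^sub>R z + (1/2) *\<^sub>R w \<in> open_segment z w"
      using that unfolding in_segment by (intro conjI exI[of _ "1/2"]) simp_all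
    then show ?thesis unfolding z(2) w(2) congruence_open_segment[OF cf] .
  qed
  have "z \<noteq> w" using uv(3) z(2) w(2) by blast
  moreover have "{z, w} \<noteq> {(1,0), (0,1)}"
  proof
    assume "{z, w} = {(1,0), (0,1)}"
    then have "(1/2) *\<^sub>R z + (1/2) *\<^sub>R w = (1/2, 1/2)" by (auto simp: doubleton_eq_iff)
    then have "f (1/2, 1/2) \<in> frontier (f ` K)"
      using mid[OF \<open>z \<noteq> w\<close>] T(2) segment_open_subset_closed[of u v] unfolding f(2) by auto
    then show False using frontier_placement[OF cf, of "(1/2, 1/2)"] by (simp add: K_eq innerK_def)
  qed
  moreover have "f (0,1) \<notin> ?V" if "{z, w} = {(0,0), (0,2)}"
  proof -
    have "(1/2) *\<^sub>R z + (1/2) *\<^sub>R w = (0, 1)" using that by (auto simp: doubleton_eq_iff)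
    then have "f (0,1) \<in> open_segment u v" using mid[OF \<open>z \<noteq> w\<close>] by simp
    then show ?thesis using uv(4) by blast
  qed
  ultimately show thesis using that f(1) z w by blast
qed

text \<open>The right-angle corners that are joined by an edge to the far end of a long leg.\<close>

definition lonely_apex :: "plane set set \<Rightarrow> plane set" where
  "lonely_apex P = {f (0,0) | f. tile_of P f \<and> f (0,1) \<notin> tiling_vertices P}"

text \<open>\<open>apex_neighbours\<close> applies to every tile through the point, so a lonely apex
  is nowhere the short-leg end (1,0) of a tile. If it is the midpoint of the long leg of
  \<open>h\<close>, then \<open>h (0,0)\<close> is such an end of another tile and hence not
  lonely.\<close>

lemma lonely_apex_position:
  assumes P: "pinwheel_tiling P" and h: "tile_of P h" and z: "z \<in> tile_points" "h z \<in> lonely_apex P"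
  shows "z = (0,0) \<or> z = (0,1) \<and> h (0,0) \<notin> lonely_apex P"
proof -
  have pos: "y = (0,0) \<or> y = (0,1) \<and> (\<exists>h''. tile_of P h'' \<and> h'' (1,0) = h' (0,0))"
    if h': "tile_of P h'" and y: "y \<in> tile_points" "h' y \<in> lonely_apex P" for h' y
  proof -
    obtain f where "h' y = f (0,0)" "tile_of P f" "f (0,1) \<notin> tiling_vertices P"
      using y(2) unfolding lonely_apex_def by blast
    then show ?thesis using apex_neighbours[OF P _ _ h' y(1)] by blast
  qed
  have "h (0,0) \<notin> lonely_apex P" if "tile_of P h'" "h' (1,0) = h (0,0)" for h'
    using pos[OF that(1), of "(1,0)"] that(2) by (auto simp: tile_points_def)
  then show ?thesis using pos[OF h z] by blast
qed

lemma pinwheel_colorable: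
  assumes P: "pinwheel_tiling P"
  shows "colorable (tiling_vertices P) (tiling_edges P) 3"
proof -
  obtain f\<^sub>0 where f\<^sub>0: "tile_of P f\<^sub>0"
    using pinwheel_tiling_nonempty[OF P] .
  then have "congruence f\<^sub>0" unfolding tile_of_def by blast
  then have inv: "inv f\<^sub>0 (f\<^sub>0 z) = z" for z by (simp add: congruence_bij bij_is_inj)
  define c :: "plane \<Rightarrow> nat" where
    "c p = (if p \<in> lonely_apex P then 2 else if even_point (inv f\<^sub>0 p) then 0 else 1)" for p
  have "c u \<noteq> c v" if edge: "{u, v} \<in> tiling_edges P" for u v
  proof -
    obtain f z w where f: "tile_of P f" and uv: "u = f z" "v = f w"
      and zw: "z \<in> tile_points" "w \<in> tile_points" "z \<noteq> w" "{z, w} \<noteq> {(1,0), (0,1)}"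
      and side: "{z, w} = {(0,0), (0,2)} \<Longrightarrow> f (0,1) \<notin> tiling_vertices P"
      using tiling_edge_cases[OF P edge] by blast
    show ?thesis
    proof (cases "u \<in> lonely_apex P \<or> v \<in> lonely_apex P")
      case True
      \<comment> \<open>Two different lonely points of one tile would have to be (0,0) and (0,1),
        and the second excludes the first.\<close>
      have "\<not> (u \<in> lonely_apex P \<and> v \<in> lonely_apex P)"
        using lonely_apex_position[OF P f zw(1)] lonely_apex_position[OF P f zw(2)] zw(3) uv by auto
      then show ?thesis using True by (auto simp: c_def)
    next
      case False
      \<comment> \<open>The frame of \<open>f\<^sub>0\<close> serves as a common reference; whether
        passing to the frame of \<open>f\<close> flips parity does not affect the comparison of two
        points of the same tile.\<close>
      obtain \<gamma> where \<gamma>: "parity_map \<gamma>" "f = f\<^sub>0 \<circ> \<gamma>" using tiling_parity[OF P f\<^sub>0 f] by blast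
      obtain e where e: "\<And>y. y \<in> tile_points \<Longrightarrow> even_point (\<gamma> y) = (even_point y = e)"
        using \<gamma>(1) int_point_quinary tile_points_int unfolding parity_map_def by metis
      have "{z, w} \<noteq> {(0,0), (0,2)}"
      proof
        assume *: "{z, w} = {(0,0), (0,2)}"
        then have "f (0,0) \<in> lonely_apex P" using side f unfolding lonely_apex_def by blast
        then show False using False * uv by (auto simp: doubleton_eq_iff)
      qed
      then have "even_point z \<noteq> even_point w"
        using zw unfolding even_tile_point[OF zw(1)] even_tile_point[OF zw(2)]
        by (auto simp: tile_points_def)
      then have "even_point (inv f\<^sub>0 u) \<noteq> even_point (inv f\<^sub>0 v)"
        unfolding uv \<gamma>(2) o_apply inv e[OF zw(1)] e[OF zw(2)] by blast
      then show ?thesis using False by (simp add: c_def)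
    qed
  qed
  moreover have "c ` tiling_vertices P \<subseteq> {..<3}" by (auto simp: c_def)
  ultimately show ?thesis unfolding colorable_def by blast
qed

section \<open>A triangle in the graph, and the lower bound\<close>

lemma pinwheel_triangle:
  assumes P: "pinwheel_tiling P"
  obtains h where "congruence h" "h ` corners \<subseteq> tiling_vertices P"
    "\<And>z w. z \<in> corners \<Longrightarrow> w \<in> corners \<Longrightarrow> z \<noteq> w \<Longrightarrow> {h z, h w} \<in> tiling_edges P"
proof -
  let ?V = "tiling_vertices P"
  obtain f\<^sub>0 where f\<^sub>0: "tile_of P f\<^sub>0"
    using pinwheel_tiling_nonempty[OF P] .
  obtain n g where g: "congruence g"
    and super: "\<And>f' z'. tile_of P f' \<Longrightarrow> z' \<in> K \<Longrightarrow> norm (f' z') \<le> norm (f\<^sub>0 (0,0)) + 5 \<Longrightarrow>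
      \<exists>F\<in>placements g n. \<exists>k\<in>kids. f' = inflate F \<circ> k"
    and sibling: "\<And>G q k. G \<in> placements g n \<Longrightarrow> q \<in> expand ` K \<Longrightarrow> norm (inflate G q) \<le> norm (f\<^sub>0 (0,0)) + 5 \<Longrightarrow>
      k \<in> kids \<Longrightarrow> tile_of P (inflate G \<circ> k)"
    by (rule pinwheel_supertiles[OF P, where R = "norm (f\<^sub>0 (0,0)) + 5"]) (rule that)
  obtain F k where F: "F \<in> placements g n" "k \<in> kids" "f\<^sub>0 = inflate F \<circ> k"
    using super[OF f\<^sub>0 zero_in_K] by auto
  have cF: "congruence (inflate F)" using inflate_congruence placements_congruence[OF g F(1)] by blast
  \<comment> \<open>The long leg of this part has the midpoint (1,1), which is interior to the
    supertile and a corner of none of the five parts.\<close>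
  define h where "h = inflate F \<circ> kid_c"
  have h: "tile_of P h"
    unfolding h_def using sibling[OF F(1) kids_K_subset[OF F(2) zero_in_K]] F(3) by (simp add: kids_def)
  then have ch: "congruence h" unfolding tile_of_def by blast
  have V: "h ` corners \<subseteq> ?V" using h unfolding tiling_vertices_iff[OF P] subset_iff by blast
  have M: "h (0,1) \<notin> ?V"
  proof
    assume "h (0,1) \<in> ?V"
    then obtain m z where m: "tile_of P m" "z \<in> corners" "h (0,1) = m z"
      unfolding tiling_vertices_iff[OF P] by blast
    have z: "z \<in> K" using m(2) corners_subset tile_points_subset_K by blast
    have h_eq: "h (0,1) = inflate F (1,1)" by (simp add: h_def kid_defs)
    have q: "int_point (1,1)" "(1,1) \<in> expand ` K" by (simp_all add: int_point_def expand_K_eq)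
    have "dist (inflate F (1,1)) (inflate F (k (0,0))) = dist (1,1) (k (0,0))" by (rule congruence_dist[OF cF])
    also have "\<dots> \<le> 5" by (rule expand_K_dist[OF q(2) kids_K_subset[OF F(2) zero_in_K]])
    finally have "norm (inflate F (1,1)) \<le> norm (f\<^sub>0 (0,0)) + 5"
      using norm_triangle_sub[of "inflate F (1,1)" "inflate F (k (0,0))"] F(3) by (simp add: dist_norm)
    then obtain H l where H: "H \<in> placements g n" "l \<in> kids" "m = inflate H \<circ> l"
      using super[OF m(1) z] m(3) h_eq by auto
    have eq: "inflate F (1,1) = inflate H (l z)" using m(3) h_eq H(3) by simp
    then have mem: "inflate F (1,1) \<in> inflate H ` expand ` K" using kids_K_subset[OF H(2) z] by blast
    have "F = H"
      using placements_transfer[OF g placements_lattice_matching[OF g] F(1) H(1) q mem]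
      by (auto simp: tile_points_def expand_def)
    then have "l z = (1,1)" using eq congruence_inj[OF cF] by simp
    then show False using m(2) H(2) unfolding kids_def by (auto simp: kid_defs)
  qed
  have edge: "{h z, h w} \<in> tiling_edges P" if zw: "z \<in> corners" "w \<in> corners" "z \<noteq> w" for z w
  proof -
    have zwK: "z \<in> K" "w \<in> K" using zw corners_subset tile_points_subset_K by blast+
    have K: "(1 - u) *\<^sub>R z + u *\<^sub>R w \<in> K" if "0 \<le> u" "u \<le> 1" for u
      using convex_convex_hull zwK that unfolding K_def by (intro convexD) simp_all
    have "x \<notin> ?V" if x: "x \<in> open_segment (h z) (h w)" for x
    proof
      assume "x \<in> ?V"
      obtain u where u: "0 < u" "u < 1" "x = (1 - u) *\<^sub>R h z + u *\<^sub>R h w"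
        using x unfolding in_segment by blast
      define y where "y = (1 - u) *\<^sub>R z + u *\<^sub>R w"
      have y: "y \<in> K" "x = h y" using K[of u] u congruence_affine[OF ch] by (simp_all add: y_def)
      obtain m c where m: "tile_of P m" "c \<in> corners" "x = m c"
        using \<open>x \<in> ?V\<close> unfolding tiling_vertices_iff[OF P] by blast
      have "m c \<in> h ` K" using y m(3) by simp
      then have "m c \<in> h ` tile_points"
        using tiling_lattice_matching[OF P m(1) h] m(2) corners_subset by blast
      then obtain y' where "y' \<in> tile_points" "h y = h y'" using y(2) m(3) by auto
      then have "y \<in> tile_points" using congruence_inj[OF ch] by simp
      \<comment> \<open>The only tile point strictly between two corners is the midpoint of the long
        leg.\<close>
      then have "y = (0,1)"
        using zw u(1,2) unfolding tile_points_def by (auto simp: y_def)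
      then show False using M \<open>x \<in> ?V\<close> y(2) by simp
    qed
    then have "open_segment (h z) (h w) \<inter> ?V = {}" by blast
    moreover have "closed_segment (h z) (h w) \<subseteq> frontier (h ` K)"
    proof
      fix x assume "x \<in> closed_segment (h z) (h w)"
      then obtain u where u: "0 \<le> u" "u \<le> 1" "x = (1 - u) *\<^sub>R h z + u *\<^sub>R h w"
        unfolding in_segment by blast
      have "(1 - u) *\<^sub>R z + u *\<^sub>R w \<notin> innerK" using zw u(1,2) by (auto simp: innerK_def)
      then show "x \<in> frontier (h ` K)"
        using frontier_placement[OF ch K[OF u(1,2)]] unfolding u(3) congruence_affine[OF ch] by blast
    qed
    moreover have "h z \<noteq> h w" using zw(3) congruence_inj[OF ch] by blast
    moreover have "h z \<in> ?V" "h w \<in> ?V" using V zw by blast+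
    moreover have "h ` K \<in> P" using h unfolding tile_of_def by blast
    ultimately show ?thesis unfolding tiling_edges_def by blast
  qed
  show thesis by (rule that[OF ch V edge])
qed

theorem theorem6p2:
  fixes P :: "plane set set"
  assumes "pinwheel_tiling P"
  shows "chromatic_number (tiling_vertices P) (tiling_edges P) = 3"
proof -
  let ?V = "tiling_vertices P" and ?E = "tiling_edges P"
  obtain h where h: "congruence h" "h ` corners \<subseteq> ?V"
    "\<And>z w. z \<in> corners \<Longrightarrow> w \<in> corners \<Longrightarrow> z \<noteq> w \<Longrightarrow> {h z, h w} \<in> ?E"
    using pinwheel_triangle[OF assms] by blast
  have "3 \<le> k" if k: "colorable ?V ?E k" for k
  proof -
    obtain c where c: "c ` ?V \<subseteq> {..<k}" "\<forall>u\<in>?V. \<forall>v\<in>?V. {u, v} \<in> ?E \<longrightarrow> c u \<noteq> c v"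
      using k unfolding colorable_def by blast
    have "inj_on (\<lambda>z. c (h z)) corners"
      using c(2) h(2,3) by (intro inj_onI) blast
    then have "card corners \<le> card {..<k}"
      by (rule card_inj_on_le) (use c(1) h(2) in auto)
    then show ?thesis by simp
  qed
  then have "3 \<le> (INF k\<in>{k. colorable ?V ?E k}. enat k)"
    by (intro INF_greatest) (simp add: numeral_eq_enat)
  moreover have "(INF k\<in>{k. colorable ?V ?E k}. enat k) \<le> enat 3"
    by (rule INF_lower) (simp add: pinwheel_colorable[OF assms])
  ultimately show ?thesis unfolding chromatic_number_def by (simp add: numeral_eq_enat)
qed

end
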